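(* Let $\mathcal{H}$ be a complex Hilbert space, let $A_1,A_2,B_1,B_2,X_1,X_2\in\mathcal{B}(\mathcal{H})$ with $A_1,A_2,B_1,B_2$ positive, and let $\mathbb{A}=\begin{bmatrix}A_1&0\\0&A_2\end{bmatrix}$, $\mathbb{B}=\begin{bmatrix}B_1&0\\0&B_2\end{bmatrix}$ and $\mathbb{Y}=\begin{bmatrix}X_1&0\\0&X_2\end{bmatrix}$ in $\mathcal{B}(\mathcal{H}\oplus\mathcal{H})$. Then for all $r\ge2$ and all $\alpha\in[0,1]$, $$\begin{aligned}\omega^r\left(\mathbb{A}^{1/2}\mathbb{Y}\mathbb{B}^{1/2}\right)\le{}&\max\{\|X_1\|^r,\|X_2\|^r\}\max\left\{\omega\left(\tfrac{A_1^r+B_1^r}{2}\right),\omega\left(\tfrac{A_2^r+B_2^r}{2}\right)\right\}\\\le{}&\tfrac12\max\{\|X_1\|^r,\|X_2\|^r\}\max\big\{\omega(\alpha A_1^r+(1-\alpha)B_1^r)+\omega((1-\alpha)A_1^r+\alpha B_1^r),\\&\qquad\qquad\omega(\alpha A_2^r+(1-\alpha)B_2^r)+\omega((1-\alpha)A_2^r+\alpha B_2^r)\big\}\\\le{}&\tfrac12\max\{\|X_1\|^r,\|X_2\|^r\}\Big(\max\left\{\|\alpha A_1^r+(1-\alpha)B_1^r\|,\|\alpha A_2^r+(1-\alpha)B_2^r\|\right\}\\&\qquad\qquad+\max\left\{\|(1-\alpha)A_1^r+\alpha B_1^r\|,\|(1-\alpha)A_2^r+\alpha B_2^r\|\ri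ght\}\Big).\end{aligned}$$
   Context: $\mathcal{B}(\cdot)$ denotes the algebra of bounded linear operators on a Hilbert space and $\|\cdot\|$ the operator norm. An operator $A$ is positive if $\langle Ax,x\rangle\ge0$ for all $x$; powers of positive operators are defined by the continuous functional calculus. The numerical radius of a bounded operator $A$ on a complex Hilbert space is $\omega(A)=\sup_{\|x\|=1}|\langle Ax,x\rangle|$, and $\omega^s(A)=(\omega(A))^s$. *)

theory Defs
  imports "HOL-Analysis.Analysis" "HOL-Computational_Algebra.Polynomial"
begin

section \<open>Complex Hilbert spaces\<close>

class complex_vector = real_vector +
  fixes scaleC :: "complex \<Rightarrow> 'a \<Rightarrow> 'a"  (infixr "*\<^sub>C" 75)
  assumes scaleC_add_right: "c *\<^sub>C (x + y) = c *\<^sub>C x + c *\<^sub>C y"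
    and scaleC_add_left: "(c + d) *\<^sub>C x = c *\<^sub>C x + d *\<^sub>C x"
    and scaleC_scaleC: "c *\<^sub>C d *\<^sub>C x = (c * d) *\<^sub>C x"
    and scaleR_scaleC: "r *\<^sub>R x = complex_of_real r *\<^sub>C x"

text \<open>The inner product is linear in the first argument.\<close>

class complex_inner = complex_vector + real_normed_vector +
  fixes cinner :: "'a \<Rightarrow> 'a \<Rightarrow> complex"
  assumes cinner_commute: "cinner x y = cnj (cinner y x)"
    and cinner_add_left: "cinner (x + y) z = cinner x z + cinner y z"
    and cinner_scaleC_left: "cinner (c *\<^sub>C x) y = c * cinner x y"
    and cinner_norm: "cinner x x = complex_of_real ((norm x)\<^sup>2)"

class complex_hilbert = complex_inner + complete_space

instance complex_hilbert \<subseteq> banach ..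

lemma norm_scaleC:
  fixes x :: "'a::complex_inner"
  shows "norm (c *\<^sub>C x) = cmod c * norm x"
proof -
  have "complex_of_real ((norm (c *\<^sub>C x))\<^sup>2) = c * cinner x (c *\<^sub>C x)"
    by (metis cinner_norm cinner_scaleC_left)
  also have "cinner x (c *\<^sub>C x) = cnj c * cinner x x"
    by (metis cinner_commute cinner_scaleC_left complex_cnj_mult)
  also have "c * (cnj c * cinner x x) = complex_of_real ((cmod c * norm x)\<^sup>2)"
    by (simp add: cinner_norm power_mult_distrib flip: mult.assoc complex_norm_square)
  finally have "(norm (c *\<^sub>C x))\<^sup>2 = (cmod c * norm x)\<^sup>2"
    using of_real_eq_iff by blast
  then show ?thesis
    by (simp add: power2_eq_iff_nonneg)
qed

instantiation complex :: complex_hilbert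
begin

definition scaleC_complex :: "complex \<Rightarrow> complex \<Rightarrow> complex"
  where "scaleC_complex c x = c * x"

definition cinner_complex :: "complex \<Rightarrow> complex \<Rightarrow> complex"
  where "cinner_complex x y = x * cnj y"

instance
  by standard
    (auto simp: scaleC_complex_def cinner_complex_def algebra_simps scaleR_conv_of_real
      simp flip: complex_norm_square)

end

text \<open>The orthogonal direct sum of two spaces is their product type, normed as in
  \<^theory>\<open>HOL-Analysis.Product_Vector\<close>.\<close>

instantiation prod :: (complex_vector, complex_vector) complex_vector
begin

definition scaleC_prod :: "complex \<Rightarrow> 'a \<times> 'b \<Rightarrow> 'a \<times> 'b"
  where "scaleC_prod c u = (c *\<^sub>C fst u, c *\<^sub>C snd u)"

instance
  by standard
    (auto simp: scaleC_prod_def prod_eq_iff scaleC_add_right scaleC_add_left scaleC_scaleC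
      scaleR_scaleC)

end

instantiation prod :: (complex_inner, complex_inner) complex_inner
begin

definition cinner_prod :: "'a \<times> 'b \<Rightarrow> 'a \<times> 'b \<Rightarrow> complex"
  where "cinner_prod u v = cinner (fst u) (fst v) + cinner (snd u) (snd v)"

instance
proof
  fix u v w :: "'a \<times> 'b" and c :: complex
  show "cinner u v = cnj (cinner v u)"
    unfolding cinner_prod_def by (metis cinner_commute complex_cnj_add)
  show "cinner (u + v) w = cinner u w + cinner v w"
    by (simp add: cinner_prod_def cinner_add_left)
  show "cinner (c *\<^sub>C u) v = c * cinner u v"
    by (simp add: cinner_prod_def scaleC_prod_def cinner_scaleC_left algebra_simps)
  show "cinner u u = complex_of_real ((norm u)\<^sup>2)"
    by (simp add: cinner_prod_def cinner_norm norm_prod_def)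
qed

end

instance prod :: (complex_hilbert, complex_hilbert) complex_hilbert ..


section \<open>Bounded operators\<close>

text \<open>The type \<^typ>\<open>'a \<Rightarrow>\<^sub>L 'a\<close> consists of the bounded \<^emph>\<open>real\<close>-linear maps; the algebra of
  bounded operators on a complex Hilbert space is its subset of complex-linear maps, with
  the same operator norm.\<close>

definition bounded_ops :: "('a::complex_hilbert \<Rightarrow>\<^sub>L 'a) set"
  where "bounded_ops = {T :: 'a \<Rightarrow>\<^sub>L 'a. \<forall>c x. T (c *\<^sub>C x) = c *\<^sub>C T x}"

definition positive_op :: "('a::complex_hilbert \<Rightarrow>\<^sub>L 'a) \<Rightarrow> bool"
  where "positive_op T \<longleftrightarrow> T \<in> bounded_ops \<and> (\<forall>x. cinner (T x) x \<in> \<real>\<^sub>\<ge>\<^sub>0)"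

text \<open>The supremum is taken in the nonnegative reals: inserting 0 only matters on the
  zero space, which has no unit vectors.\<close>

definition numerical_radius :: "('a::complex_hilbert \<Rightarrow>\<^sub>L 'a) \<Rightarrow> real"
  where "numerical_radius T = Sup (insert 0 {cmod (cinner (T x) x) | x. norm x = 1})"

lift_definition block_op ::
  "('a::complex_hilbert \<Rightarrow>\<^sub>L 'a) \<Rightarrow> ('a \<Rightarrow>\<^sub>L 'a) \<Rightarrow> ('a \<Rightarrow>\<^sub>L 'a) \<Rightarrow> ('a \<Rightarrow>\<^sub>L 'a) \<Rightarrow> ('a \<times> 'a) \<Rightarrow>\<^sub>L ('a \<times> 'a)"
  is "\<lambda>P Q R S (x, y). (P x + Q y, R x + S y)"
  unfolding case_prod_beta
  by (intro bounded_linear_Pair bounded_linear_add bounded_linear_compose[OF _ bounded_linear_fst]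
      bounded_linear_compose[OF _ bounded_linear_snd])


section \<open>Continuous functional calculus\<close>

lift_definition scaleC_op ::
  "complex \<Rightarrow> ('a::complex_hilbert \<Rightarrow>\<^sub>L 'a) \<Rightarrow> ('a \<Rightarrow>\<^sub>L 'a)"
  is "\<lambda>c T x. c *\<^sub>C T x"
proof -
  fix c :: complex and T :: "'a \<Rightarrow> 'a"
  assume T: "bounded_linear T"
  have "bounded_linear (\<lambda>x::'a. c *\<^sub>C x)"
    by (rule bounded_linear_intro[where K = "cmod c"])
      (simp_all add: scaleC_add_right scaleR_scaleC scaleC_scaleC norm_scaleC mult.commute)
  then show "bounded_linear (\<lambda>x. c *\<^sub>C T x)"
    using T by (rule bounded_linear_compose)
qed

definition spectrum :: "('a::complex_hilbert \<Rightarrow>\<^sub>L 'a) \<Rightarrow> complex set"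
  where "spectrum T =
    {z. \<not> (\<exists>S \<in> bounded_ops. S o\<^sub>L (T - scaleC_op z id_blinfun) = id_blinfun
                        \<and> (T - scaleC_op z id_blinfun) o\<^sub>L S = id_blinfun)}"

definition poly_op :: "complex poly \<Rightarrow> ('a::complex_hilbert \<Rightarrow>\<^sub>L 'a) \<Rightarrow> ('a \<Rightarrow>\<^sub>L 'a)"
  where "poly_op p T = (\<Sum>i\<le>degree p. scaleC_op (coeff p i) (((o\<^sub>L) T ^^ i) id_blinfun))"

text \<open>For self-adjoint \<open>T\<close> and \<open>f\<close> continuous on the spectrum of \<open>T\<close>, the operator \<open>f(T)\<close> is the
  value at \<open>f\<close> of the continuous extension of \<open>p \<mapsto> p(T)\<close> from polynomials to all
  continuous functions on the spectrum (supremum norm on functions, operator norm on operators):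
  the common limit of \<open>p n (T)\<close> over all sequences of polynomials \<open>p n\<close> that converge to \<open>f\<close>
  uniformly on the spectrum. Since the spectrum is a compact set of reals, such sequences exist
  by the Weierstrass theorem, so there is exactly one such operator.\<close>

definition cont_fun_calc ::
  "(complex \<Rightarrow> complex) \<Rightarrow> ('a::complex_hilbert \<Rightarrow>\<^sub>L 'a) \<Rightarrow> ('a \<Rightarrow>\<^sub>L 'a)"
  where "cont_fun_calc f T =
    (THE S. S \<in> bounded_ops \<and>
      (\<forall>p. uniform_limit (spectrum T) (\<lambda>n. poly (p n)) f sequentially
        \<longrightarrow> (\<lambda>n. poly_op (p n) T) \<longlonglongrightarrow> S))"

text \<open>Meant for positive \<open>T\<close>, whose spectrum lies in the nonnegative reals, and exponents
  \<open>s > 0\<close>, for which \<open>t \<mapsto> t powr s\<close> is continuous there, 0 included.\<close>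

definition op_powr :: "('a::complex_hilbert \<Rightarrow>\<^sub>L 'a) \<Rightarrow> real \<Rightarrow> ('a \<Rightarrow>\<^sub>L 'a)"  (infixr "powr\<^sub>o\<^sub>p" 80)
  where "T powr\<^sub>o\<^sub>p s = cont_fun_calc (\<lambda>z. complex_of_real (Re z powr s)) T"

end

theory Submission
  imports Defs "HOL-Computational_Algebra.Fundamental_Theorem_Algebra"
begin

text \<open>For a self-adjoint \<open>T\<close>, the infimum \<open>m\<close> of the numerical range of a self-adjoint \<open>p(T)\<close> makes
  \<open>p(T) - m\<close> non-invertible; factoring \<open>p - m\<close> into linear factors gives a point \<open>z\<close> of the spectrum
  of \<open>T\<close> with \<open>p(z) = m\<close>. Hence polynomial inequalities on the spectrum pass to operators, without
  the spectral radius formula, and with \<open>p\<close> replaced by \<open>- \<bar>p\<bar>\<^sup>2\<close> they bound the operator norm,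
  so the continuous functional calculus exists.

  For a unit vector \<open>u\<close>, Cauchy-Schwarz bounds \<open>\<bar>\<langle>\<AA>\<^sup>1\<^sup>/\<^sup>2 \<YY> \<BB>\<^sup>1\<^sup>/\<^sup>2 u, u\<rangle>\<bar>\<close> by
  \<open>\<parallel>\<YY>\<parallel> \<langle>\<AA> u, u\<rangle>\<^sup>1\<^sup>/\<^sup>2 \<langle>\<BB> u, u\<rangle>\<^sup>1\<^sup>/\<^sup>2\<close>. The first inequality then follows from the arithmetic-geometric
  mean and McCarthy's inequality \<open>\<langle>A u, u\<rangle>\<^sup>r \<le> \<langle>A\<^sup>r u, u\<rangle>\<close>, which is the operator form of a tangent
  line bound for \<open>t \<mapsto> t\<^sup>r\<close>; the other two are triangle inequalities.\<close>

section \<open>Inner products and bounded operators\<close>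

lemma cinner_add_right: "cinner x (y + z) = cinner x y + cinner x z" for x :: "'a::complex_inner"
  by (metis cinner_commute cinner_add_left complex_cnj_add)

lemma cinner_scaleC_right: "cinner x (c *\<^sub>C y) = cnj c * cinner x y" for x :: "'a::complex_inner"
  by (metis cinner_commute cinner_scaleC_left complex_cnj_mult)

lemma cinner_scaleR_left: "cinner (a *\<^sub>R x) y = of_real a * cinner x y" for x :: "'a::complex_inner"
  by (simp add: scaleR_scaleC cinner_scaleC_left)

lemma cinner_scaleR_right: "cinner x (a *\<^sub>R y) = of_real a * cinner x y" for x :: "'a::complex_inner"
  by (simp add: scaleR_scaleC cinner_scaleC_right)

lemma cinner_zero_left [simp]: "cinner 0 x = 0" for x :: "'a::complex_inner"
  using cinner_scaleR_left[of 0 x x] by simp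

lemma cinner_zero_right [simp]: "cinner x 0 = 0" for x :: "'a::complex_inner"
  using cinner_scaleR_right[of x 0 x] by simp

lemma cinner_minus_left: "cinner (- x) y = - cinner x y" for x :: "'a::complex_inner"
  using cinner_scaleR_left[of "-1" x y] by simp

lemma cinner_minus_right: "cinner x (- y) = - cinner x y" for x :: "'a::complex_inner"
  using cinner_scaleR_right[of x "-1" y] by simp

lemma cinner_diff_left: "cinner (x - y) z = cinner x z - cinner y z" for x :: "'a::complex_inner"
  using cinner_add_left[of x "- y" z] by (simp add: cinner_minus_left)

lemma cinner_diff_right: "cinner x (y - z) = cinner x y - cinner x z" for x :: "'a::complex_inner"
  using cinner_add_right[of x y "- z"] by (simp add: cinner_minus_right)

lemmas cinner_simps = cinner_add_left cinner_add_right cinner_diff_left cinner_diff_right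
  cinner_scaleC_left cinner_scaleC_right cinner_scaleR_left cinner_scaleR_right

lemma Re_cinner_commute: "Re (cinner x y) = Re (cinner y x)" for x :: "'a::complex_inner"
  by (metis cinner_commute complex_cnj(1) complex.collapse complex.sel(1))

lemma Re_cinner_self: "Re (cinner x x) = (norm x)\<^sup>2" for x :: "'a::complex_inner"
  by (simp add: cinner_norm)

lemma norm_diff_power2: "(norm (x - y))\<^sup>2 = (norm x)\<^sup>2 - 2 * Re (cinner x y) + (norm y)\<^sup>2"
  for x :: "'a::complex_inner"
  using Re_cinner_commute[of x y] by (simp add: cinner_simps flip: Re_cinner_self)

lemma cmod_cinner_le: "cmod (cinner x y) \<le> norm x * norm y" for x :: "'a::complex_inner"
proof (cases "y = 0")
  case False
  let ?c = "cinner x y" and ?n = "norm y ^ 2"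
  have "Re (cinner (?n *\<^sub>R x) (?c *\<^sub>C y)) = ?n * (cmod ?c)\<^sup>2"
    by (simp add: cinner_simps cmod_power2) (simp add: power2_eq_square algebra_simps)
  moreover have "0 \<le> (norm (?n *\<^sub>R x - ?c *\<^sub>C y))\<^sup>2"
    by simp
  ultimately have "0 \<le> (?n * norm x)\<^sup>2 - 2 * (?n * (cmod ?c)\<^sup>2) + (cmod ?c * norm y)\<^sup>2"
    by (simp add: norm_diff_power2 norm_scaleC)
  then have "?n * (cmod ?c)\<^sup>2 \<le> ?n * (norm x * norm y)\<^sup>2"
    by (simp add: power2_eq_square algebra_simps)
  then have "(cmod ?c)\<^sup>2 \<le> (norm x * norm y)\<^sup>2"
    using False by simp
  then show ?thesis
    by (rule power2_le_imp_le) simp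
qed simp

lemma blinfun_ext_iff: "S = T \<longleftrightarrow> (\<forall>x. blinfun_apply S x = blinfun_apply T x)"
  by (auto intro: blinfun_eqI)

lemma bounded_ops_scaleC: "(T :: 'a::complex_hilbert \<Rightarrow>\<^sub>L 'a) \<in> bounded_ops \<Longrightarrow> T (c *\<^sub>C x) = c *\<^sub>C T x"
  by (simp add: bounded_ops_def)

lemma bounded_opsI: "(\<And>c x. blinfun_apply T (c *\<^sub>C x) = c *\<^sub>C T x) \<Longrightarrow> T \<in> bounded_ops"
  by (simp add: bounded_ops_def)

lemma scaleC_diff_right: "c *\<^sub>C (x - y) = c *\<^sub>C x - c *\<^sub>C y" for x :: "'a::complex_vector"
  by (metis scaleC_add_right add_diff_cancel diff_add_cancel)

lemma scaleC_zero_right [simp]: "c *\<^sub>C 0 = (0 :: 'a::complex_vector)"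
  using scaleC_add_right[of c 0 "0 :: 'a"] by simp

lemma scaleC_zero_left [simp]: "0 *\<^sub>C x = (0 :: 'a::complex_vector)"
  using scaleR_scaleC[of 0 x] by simp

lemma scaleC_one [simp]: "1 *\<^sub>C x = (x :: 'a::complex_vector)"
  using scaleR_scaleC[of 1 x] by simp

lemma scaleC_minus_left: "(- c) *\<^sub>C x = - (c *\<^sub>C x)" for x :: "'a::complex_vector"
  using scaleC_add_left[of "- c" c x] by (simp add: eq_neg_iff_add_eq_0)

lemma id_bounded_ops: "id_blinfun \<in> bounded_ops"
  by (simp add: bounded_ops_def)

lemma add_bounded_ops: "S \<in> bounded_ops \<Longrightarrow> T \<in> bounded_ops \<Longrightarrow> S + T \<in> bounded_ops"
  by (simp add: bounded_ops_def blinfun.add_left scaleC_add_right)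

lemma diff_bounded_ops: "S \<in> bounded_ops \<Longrightarrow> T \<in> bounded_ops \<Longrightarrow> S - T \<in> bounded_ops"
  by (simp add: bounded_ops_def blinfun.diff_left scaleC_diff_right)

lemma compose_bounded_ops: "S \<in> bounded_ops \<Longrightarrow> T \<in> bounded_ops \<Longrightarrow> S o\<^sub>L T \<in> bounded_ops"
  by (simp add: bounded_ops_def)

lemma scaleC_op_apply [simp]: "blinfun_apply (scaleC_op c T) x = c *\<^sub>C T x"
  by (simp add: scaleC_op.rep_eq)

lemma scaleC_op_bounded_ops: "T \<in> bounded_ops \<Longrightarrow> scaleC_op c T \<in> bounded_ops"
  by (simp add: bounded_ops_def scaleC_scaleC mult.commute)

lemma tendsto_scaleC: "(f \<longlongrightarrow> l) F \<Longrightarrow> ((\<lambda>n. c *\<^sub>C f n) \<longlongrightarrow> c *\<^sub>C l) F"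
  for f :: "_ \<Rightarrow> 'a::complex_inner"
proof -
  have "bounded_linear (\<lambda>x::'a. c *\<^sub>C x)"
    by (rule bounded_linear_intro[where K = "cmod c"])
      (simp_all add: scaleC_add_right scaleR_scaleC scaleC_scaleC norm_scaleC mult.commute)
  then show "(f \<longlongrightarrow> l) F \<Longrightarrow> ((\<lambda>n. c *\<^sub>C f n) \<longlongrightarrow> c *\<^sub>C l) F"
    by (rule bounded_linear.tendsto)
qed

lemma tendsto_blinfun_apply: "S \<longlonglongrightarrow> T \<Longrightarrow> (\<lambda>n. blinfun_apply (S n) x) \<longlonglongrightarrow> T x"
  by (intro tendsto_intros)

lemma bounded_ops_limit:
  assumes "\<And>n. S n \<in> bounded_ops" "S \<longlonglongrightarrow> T"
  shows "T \<in> bounded_ops"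
proof (rule bounded_opsI)
  fix c x
  have "(\<lambda>n. S n (c *\<^sub>C x)) \<longlonglongrightarrow> c *\<^sub>C T x"
    using assms by (simp add: bounded_ops_scaleC tendsto_scaleC tendsto_blinfun_apply)
  then show "T (c *\<^sub>C x) = c *\<^sub>C T x"
    using assms(2) LIMSEQ_unique tendsto_blinfun_apply by blast
qed

lemma tendsto_cinner_left:
  fixes f :: "nat \<Rightarrow> 'a::complex_inner"
  assumes "f \<longlonglongrightarrow> l"
  shows "(\<lambda>n. cinner (f n) y) \<longlonglongrightarrow> cinner l y"
proof -
  have "bounded_linear (\<lambda>x. cinner x y)"
    by (rule bounded_linear_intro[where K = "norm y"])
      (auto simp: cinner_simps scaleR_conv_of_real cmod_cinner_le)
  then show ?thesis
    using assms by (rule bounded_linear.tendsto)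
qed

section \<open>Self-adjoint and positive operators\<close>

definition selfadjoint_op :: "('a::complex_hilbert \<Rightarrow>\<^sub>L 'a) \<Rightarrow> bool"
  where "selfadjoint_op T \<longleftrightarrow> T \<in> bounded_ops \<and> (\<forall>x y. cinner (T x) y = cinner x (T y))"

lemma selfadjoint_op_bounded_ops: "selfadjoint_op T \<Longrightarrow> T \<in> bounded_ops"
  by (simp add: selfadjoint_op_def)

lemma selfadjoint_op_cinner: "selfadjoint_op T \<Longrightarrow> cinner (blinfun_apply T x) y = cinner x (T y)"
  by (simp add: selfadjoint_op_def)

lemma selfadjoint_op_limit:
  assumes S: "\<And>n. selfadjoint_op (S n)" and lim: "S \<longlonglongrightarrow> T"
  shows "selfadjoint_op T"
  unfolding selfadjoint_op_def
proof (intro conjI allI)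
  show "T \<in> bounded_ops"
    using bounded_ops_limit S lim selfadjoint_op_bounded_ops by blast
  fix x y
  have "(\<lambda>n. cinner (S n x) y) \<longlonglongrightarrow> cinner (T x) y" for x y
    by (intro tendsto_cinner_left tendsto_blinfun_apply lim)
  \<comment> \<open>Continuity in the second argument is obtained from the first by conjugating and
    swapping x and y.\<close>
  moreover from this have "(\<lambda>n. cnj (cinner (S n y) x)) \<longlonglongrightarrow> cnj (cinner (T y) x)"
    by (intro tendsto_intros)
  then have "(\<lambda>n. cinner (S n x) y) \<longlonglongrightarrow> cinner x (T y)"
    by (simp add: selfadjoint_op_cinner[OF S] flip: cinner_commute)
  ultimately show "cinner (T x) y = cinner x (T y)"
    using LIMSEQ_unique by blast
qed

text \<open>Polarization: since the quadratic form is real, its value at x + y fixes the imaginary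
  part of \<open>cinner (T x) y\<close>, and its value at x + iy fixes the real part.\<close>

lemma positive_op_selfadjoint:
  assumes "positive_op T"
  shows "selfadjoint_op T"
  unfolding selfadjoint_op_def
proof (intro conjI allI)
  show T: "T \<in> bounded_ops"
    using assms by (simp add: positive_op_def)
  fix x y
  have im: "Im (cinner (T u) u) = 0" for u
    using assms complex_is_Real_iff nonneg_Reals_subset_Reals by (auto simp: positive_op_def)
  have "Im (cinner (T x) y) + Im (cinner (T y) x) = 0"
    using im[of "x + y"] im[of x] im[of y] by (simp add: blinfun.add_right cinner_simps)
  moreover have "Re (cinner (T x) y) = Re (cinner (T y) x)"
    using im[of "x + \<i> *\<^sub>C y"] im[of x] im[of y]
    by (simp add: blinfun.add_right bounded_ops_scaleC[OF T] cinner_simps)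
  ultimately have "cinner (T x) y = cnj (cinner (T y) x)"
    by (simp add: complex_eq_iff)
  then show "cinner (T x) y = cinner x (T y)"
    by (simp flip: cinner_commute)
qed

lemma positive_op_Re_nonneg: "positive_op T \<Longrightarrow> 0 \<le> Re (cinner (blinfun_apply T x) x)"
  by (auto simp: positive_op_def complex_nonneg_Reals_iff)

lemma Re_cinner_le_norm: "Re (cinner (T x) x) \<le> norm T * (norm x)\<^sup>2" for T :: "'a::complex_hilbert \<Rightarrow>\<^sub>L 'a"
proof -
  have "Re (cinner (T x) x) \<le> norm (T x) * norm x"
    using cmod_cinner_le complex_Re_le_cmod order_trans by blast
  also have "\<dots> \<le> (norm T * norm x) * norm x"
    by (intro mult_right_mono norm_blinfun norm_ge_zero)
  finally show ?thesis
    by (simp add: power2_eq_square mult.assoc)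
qed

text \<open>Expand \<open>0 \<le> \<langle>P (x - t P x), x - t P x\<rangle>\<close> at \<open>t = 1 / K\<close>.\<close>

lemma norm_power2_le_of_nonneg:
  assumes P: "selfadjoint_op P" "\<And>x. 0 \<le> Re (cinner (P x) x)" and K: "norm P \<le> K" "0 < K"
  shows "(norm (P x))\<^sup>2 \<le> K * Re (cinner (P x) x)"
proof -
  let ?t = "1 / K"
  have "0 \<le> Re (cinner (P (x - ?t *\<^sub>R P x)) (x - ?t *\<^sub>R P x))"
    by (rule P)
  also have "\<dots> = Re (cinner (P x) x) - ?t * (Re (cinner (P x) (P x)) + Re (cinner (P x) (P x)))
      + ?t\<^sup>2 * Re (cinner (P (P x)) (P x))"
    by (simp add: blinfun.diff_right blinfun.scaleR_right cinner_simps
        selfadjoint_op_cinner[OF P(1), of "P x" x] power2_eq_square diff_divide_distrib)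
  also have "\<dots> = Re (cinner (P x) x) - 2 * ?t * (norm (P x))\<^sup>2 + ?t\<^sup>2 * Re (cinner (P (P x)) (P x))"
    by (simp add: Re_cinner_self)
  also have "\<dots> \<le> Re (cinner (P x) x) - 2 * ?t * (norm (P x))\<^sup>2 + ?t\<^sup>2 * (K * (norm (P x))\<^sup>2)"
    using Re_cinner_le_norm[of P "P x"] mult_right_mono[OF K(1), of "(norm (P x))\<^sup>2"]
    by (intro add_left_mono mult_left_mono) auto
  also have "\<dots> = Re (cinner (P x) x) - (norm (P x))\<^sup>2 / K"
    using K(2) by (simp add: field_simps power2_eq_square)
  finally show ?thesis
    using K(2) by (simp add: field_simps)
qed

section \<open>Invertibility and the infimum of the numerical range\<close>

definition invertible_op :: "('a::complex_hilbert \<Rightarrow>\<^sub>L 'a) \<Rightarrow> bool"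
  where "invertible_op T \<longleftrightarrow>
    (\<exists>S \<in> bounded_ops. S o\<^sub>L T = id_blinfun \<and> T o\<^sub>L S = id_blinfun)"

lemma spectrum_iff: "z \<in> spectrum T \<longleftrightarrow> \<not> invertible_op (T - scaleC_op z id_blinfun)"
  by (simp add: spectrum_def invertible_op_def)

lemma invertible_op_compose:
  assumes "invertible_op S" "invertible_op T"
  shows "invertible_op (S o\<^sub>L T)"
proof -
  obtain S' T' where "S' \<in> bounded_ops" "S' o\<^sub>L S = id_blinfun" "S o\<^sub>L S' = id_blinfun"
    and "T' \<in> bounded_ops" "T' o\<^sub>L T = id_blinfun" "T o\<^sub>L T' = id_blinfun"
    using assms by (auto simp: invertible_op_def)
  moreover from this have "(T' o\<^sub>L S') o\<^sub>L (S o\<^sub>L T) = id_blinfun" "(S o\<^sub>L T) o\<^sub>L (T' o\<^sub>L S') = id_blinfun"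
    by (auto simp: blinfun_ext_iff)
  ultimately show ?thesis
    unfolding invertible_op_def using compose_bounded_ops by blast
qed

text \<open>The inverse R of the product commutes with T, because T commutes with S o T. Hence T o R
  is a two-sided inverse of S.\<close>

lemma invertible_op_factor:
  assumes comm: "S o\<^sub>L T = T o\<^sub>L S" and inv: "invertible_op (S o\<^sub>L T)" and T: "T \<in> bounded_ops"
  shows "invertible_op S"
proof -
  obtain R where R: "R \<in> bounded_ops" "R o\<^sub>L (S o\<^sub>L T) = id_blinfun" "(S o\<^sub>L T) o\<^sub>L R = id_blinfun"
    using inv by (auto simp: invertible_op_def)
  have R': "R (S (T x)) = x" "S (T (R x)) = x" for x
    using R(2,3) by (auto simp: blinfun_ext_iff)
  have comm': "S (T x) = T (S x)" for x
    using arg_cong[OF comm, of "\<lambda>U. blinfun_apply U x"] by simp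
  have "R (T x) = T (R x)" for x
    by (metis R' comm')
  then have "T (R (S x)) = x" for x
    by (metis R'(1) comm')
  then have "(T o\<^sub>L R) o\<^sub>L S = id_blinfun" "S o\<^sub>L (T o\<^sub>L R) = id_blinfun"
    by (auto intro!: blinfun_eqI simp: R')
  then show ?thesis
    unfolding invertible_op_def using compose_bounded_ops R(1) T by blast
qed

lemma invertible_op_uminus:
  assumes "invertible_op (- T)"
  shows "invertible_op T"
proof -
  obtain R where R: "R \<in> bounded_ops" "R o\<^sub>L (- T) = id_blinfun" "(- T) o\<^sub>L R = id_blinfun"
    using assms by (auto simp: invertible_op_def)
  have "- R \<in> bounded_ops"
    using diff_bounded_ops[OF _ R(1), of 0] by (simp add: bounded_ops_def)
  moreover have "(- R) o\<^sub>L T = id_blinfun" "T o\<^sub>L (- R) = id_blinfun"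
    using R by (auto simp: blinfun_ext_iff blinfun.minus_left blinfun.minus_right)
  ultimately show ?thesis
    by (auto simp: invertible_op_def)
qed

text \<open>The solution of \<open>P x = y\<close> is the fixed point of \<open>x \<mapsto> x - (P x - y) / K\<close>, which is a
  contraction for large \<open>K\<close>.\<close>

lemma invertible_op_bounded_below:
  assumes P: "selfadjoint_op P" and c: "0 < c" "\<And>x. c * (norm x)\<^sup>2 \<le> Re (cinner (P x) x)"
  shows "invertible_op P"
proof -
  \<comment> \<open>K dominates \<open>norm P\<close>, as \<open>norm_power2_le_of_nonneg\<close>
    demands, and c, so that the squared contraction factor 1 - c / K is nonnegative.\<close>
  define K where "K = norm P + c"
  have K: "norm P \<le> K" "0 < K" "c \<le> K"
    using c(1) by (auto simp: K_def intro: add_nonneg_pos)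
  have nn: "0 \<le> Re (cinner (P x) x)" for x
    using c(2)[of x] c(1) by (meson order_trans mult_nonneg_nonneg less_imp_le zero_le_power2)
  have below: "c * norm x \<le> norm (P x)" for x
  proof (cases "x = 0")
    case False
    have "c * (norm x)\<^sup>2 \<le> norm (P x) * norm x"
      using c(2)[of x] cmod_cinner_le[of "P x" x] complex_Re_le_cmod[of "cinner (P x) x"] by linarith
    then show ?thesis
      using False by (simp add: power2_eq_square)
  qed simp
  \<comment> \<open>In the expanded square, \<open>norm_power2_le_of_nonneg\<close> lets the
    quadratic term consume only half of the negative linear term; the other half is bounded by
    c.\<close>
  have contr: "norm (v - (1 / K) *\<^sub>R P v) \<le> sqrt (1 - c / K) * norm v" for v
  proof (rule power2_le_imp_le)
    have "(norm (v - (1 / K) *\<^sub>R P v))\<^sup>2 =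
        (norm v)\<^sup>2 - 2 / K * Re (cinner (P v) v) + (norm (P v))\<^sup>2 / K\<^sup>2"
      using Re_cinner_commute[of v "P v"]
      by (simp add: norm_diff_power2 cinner_simps power_divide)
    also have "\<dots> \<le> (norm v)\<^sup>2 - 2 / K * Re (cinner (P v) v) + (K * Re (cinner (P v) v)) / K\<^sup>2"
      by (intro add_left_mono divide_right_mono norm_power2_le_of_nonneg P nn K) auto
    also have "\<dots> = (norm v)\<^sup>2 - Re (cinner (P v) v) / K"
      using K(2) by (simp add: power2_eq_square field_simps)
    also have "\<dots> \<le> (norm v)\<^sup>2 - (c * (norm v)\<^sup>2) / K"
      using K(2) by (intro diff_left_mono divide_right_mono c(2)) auto
    also have "\<dots> = (sqrt (1 - c / K) * norm v)\<^sup>2"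
      using K by (simp add: power_mult_distrib field_simps)
    finally show "(norm (v - (1 / K) *\<^sub>R P v))\<^sup>2 \<le> (sqrt (1 - c / K) * norm v)\<^sup>2" .
    show "0 \<le> sqrt (1 - c / K) * norm v"
      using K by simp
  qed
  have "\<exists>x. P x = y" for y
  proof -
    have "\<exists>!x. x - (1 / K) *\<^sub>R (P x - y) = x"
    proof (rule banach_fix_type)
      show "0 \<le> sqrt (1 - c / K)" "sqrt (1 - c / K) < 1"
        using K c(1) by auto
      show "\<forall>x x'. dist (x - (1 / K) *\<^sub>R (P x - y)) (x' - (1 / K) *\<^sub>R (P x' - y))
          \<le> sqrt (1 - c / K) * dist x x'"
      proof (intro allI)
        fix x x'
        have "(x - (1 / K) *\<^sub>R (P x - y)) - (x' - (1 / K) *\<^sub>R (P x' - y))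
            = (x - x') - (1 / K) *\<^sub>R P (x - x')"
          by (simp add: blinfun.diff_right algebra_simps)
        then show "dist (x - (1 / K) *\<^sub>R (P x - y)) (x' - (1 / K) *\<^sub>R (P x' - y))
          \<le> sqrt (1 - c / K) * dist x x'"
          using contr[of "x - x'"] by (simp only: dist_norm)
      qed
    qed
    then show ?thesis
      using K(2) by auto
  qed
  then obtain g where g: "P (g y) = y" for y
    by metis
  have inj: "x = y" if "P x = P y" for x y
    using below[of "x - y"] that c(1) by (simp add: blinfun.diff_right mult_le_0_iff)
  have lin: "bounded_linear g"
  proof (rule bounded_linear_intro[where K = "1 / c"])
    show "g (x + y) = g x + g y" for x y
      by (rule inj) (simp add: g blinfun.add_right)
    show "g (a *\<^sub>R x) = a *\<^sub>R g x" for a x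
      by (rule inj) (simp add: g blinfun.scaleR_right)
    show "norm (g x) \<le> norm x * (1 / c)" for x
      using below[of "g x"] c(1) by (simp add: g field_simps)
  qed
  \<comment> \<open>So far g is only real-linear; complex homogeneity follows from the injectivity
    of P in the same way as additivity.\<close>
  have "Blinfun g \<in> bounded_ops"
    by (rule bounded_opsI, rule inj)
      (simp add: g bounded_linear_Blinfun_apply[OF lin]
        bounded_ops_scaleC[OF selfadjoint_op_bounded_ops[OF P]])
  moreover have "g (P x) = x" for x
    by (rule inj) (simp add: g)
  ultimately show ?thesis
    unfolding invertible_op_def
    by (intro bexI[of _ "Blinfun g"] conjI blinfun_eqI)
      (auto simp: g bounded_linear_Blinfun_apply[OF lin])
qed

lemma scaleC_op_of_real: "scaleC_op (of_real a) T = a *\<^sub>R T"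
  by (rule blinfun_eqI) (simp add: blinfun.scaleR_left scaleR_scaleC)

lemma selfadjoint_op_diff_scaleR:
  "selfadjoint_op T \<Longrightarrow> selfadjoint_op (T - a *\<^sub>R id_blinfun)"
  unfolding selfadjoint_op_def
  by (auto simp: blinfun.diff_left blinfun.scaleR_left cinner_simps
      intro!: diff_bounded_ops scaleC_op_bounded_ops id_bounded_ops simp flip: scaleC_op_of_real)

text \<open>The number \<open>m\<close> is the infimum of the numerical range. If \<open>P = Q - m\<close> had an inverse \<open>R\<close>, then
  \<open>1 = \<parallel>R (P x)\<parallel>\<^sup>2 \<le> \<parallel>R\<parallel>\<^sup>2 K \<langle>P x, x\<rangle>\<close> on unit vectors would keep \<open>\<langle>P x, x\<rangle>\<close> away from \<open>0\<close>.\<close>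

lemma selfadjoint_op_inf_spectrum:
  fixes Q :: "'a::complex_hilbert \<Rightarrow>\<^sub>L 'a"
  assumes Q: "selfadjoint_op Q" and ne: "u \<noteq> (0 :: 'a)"
  obtains m where "\<And>x. m * (norm x)\<^sup>2 \<le> Re (cinner (Q x) x)"
    and "\<not> invertible_op (Q - m *\<^sub>R id_blinfun)"
proof -
  define N where "N = {Re (cinner (Q x) x) | x. norm x = 1}"
  define m where "m = Inf N"
  have scale: "Re (cinner (Q x) x) = (norm x)\<^sup>2 * Re (cinner (Q (sgn x)) (sgn x))" if "x \<noteq> 0" for x
    using that by (simp add: sgn_div_norm blinfun.scaleR_right cinner_simps power2_eq_square field_simps)
  have "- norm Q \<le> Re (cinner (Q x) x)" if "norm x = 1" for x
    using Re_cinner_le_norm[of "- Q" x] that by (simp add: blinfun.minus_left cinner_minus_left)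
  then have bdd: "bdd_below N"
    by (auto simp: N_def intro!: bdd_belowI)
  have N_ne: "N \<noteq> {}"
    using ne norm_sgn[of u] by (auto simp: N_def)
  have m_le: "m * (norm x)\<^sup>2 \<le> Re (cinner (Q x) x)" for x
  proof (cases "x = 0")
    case False
    then have "m \<le> Re (cinner (Q (sgn x)) (sgn x))"
      unfolding m_def by (intro cInf_lower bdd) (auto simp: N_def norm_sgn)
    then show ?thesis
      using scale[OF False] by (simp add: mult.commute[of m] mult_left_mono)
  qed simp
  define P where "P = Q - m *\<^sub>R id_blinfun"
  have P_cinner: "Re (cinner (P x) x) = Re (cinner (Q x) x) - m * (norm x)\<^sup>2" for x
    by (simp add: P_def blinfun.diff_left blinfun.scaleR_left cinner_simps Re_cinner_self)
  have "\<not> invertible_op P"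
  proof
    assume "invertible_op P"
    then obtain R where "R o\<^sub>L P = id_blinfun"
      by (auto simp: invertible_op_def)
    then have R: "R (P x) = x" for x
      by (auto simp: blinfun_ext_iff)
    define K where "K = norm P + 1"
    define L where "L = (norm R)\<^sup>2 * K"
    have K: "norm P \<le> K" "0 < K"
      by (auto simp: K_def intro: add_nonneg_pos)
    have gap: "1 \<le> L * (Re (cinner (Q x) x) - m)" if "norm x = 1" for x
    proof -
      have "1 \<le> norm R * norm (P x)"
        using norm_blinfun[of R "P x"] by (simp add: R that)
      then have "1 \<le> (norm R * norm (P x))\<^sup>2"
        by (simp add: one_le_power)
      also have "\<dots> \<le> (norm R)\<^sup>2 * (K * Re (cinner (P x) x))"
        unfolding power_mult_distrib
        by (intro mult_left_mono norm_power2_le_of_nonneg K)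
          (simp_all add: P_cinner m_le, simp add: P_def selfadjoint_op_diff_scaleR[OF Q])
      finally show ?thesis
        by (simp add: L_def P_cinner that)
    qed
    \<comment> \<open>With L = 0, \<open>gap\<close> would read 1 <= 0 at a unit vector; one exists
      because u is nonzero.\<close>
    have "0 < L"
    proof -
      obtain x :: 'a where x: "norm x = 1"
        using norm_sgn[of u] ne by metis
      have "L \<noteq> 0"
        using gap[OF x] by auto
      then show ?thesis
        using K(2) by (simp add: L_def)
    qed
    then have "m + 1 / L \<le> t" if "t \<in> N" for t
      using that gap by (auto simp: N_def field_simps)
    then have "m + 1 / L \<le> m"
      unfolding m_def by (intro cInf_greatest N_ne)
    then show False
      using \<open>0 < L\<close> by (simp add: field_simps)
  qed
  then show thesis
    using that m_le P_def by blast
qed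

section \<open>Polynomials of operators\<close>

lemma poly_op_apply: "poly_op p T x = (\<Sum>i\<le>degree p. coeff p i *\<^sub>C (blinfun_apply T ^^ i) x)"
proof -
  have "blinfun_apply (((o\<^sub>L) T ^^ i) id_blinfun) x = (blinfun_apply T ^^ i) x" for i
    by (induction i) auto
  then show ?thesis
    by (simp add: poly_op_def blinfun.sum_left)
qed

lemma poly_op_0 [simp]: "poly_op 0 T = 0"
  by (rule blinfun_eqI) (simp add: poly_op_apply)

text \<open>Horner's recursion, the basis of the inductions over polynomials that follow.\<close>

lemma poly_op_pCons:
  assumes T: "T \<in> bounded_ops"
  shows "poly_op (pCons a p) T x = a *\<^sub>C x + T (poly_op p T x)"
proof -
  \<comment> \<open>For p = 0 the degree of \<open>pCons a p\<close> is 0 rather than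
    \<open>Suc (degree p)\<close>; the extra summand then has coefficient 0.\<close>
  have "poly_op (pCons a p) T x
      = (\<Sum>i\<le>Suc (degree p). coeff (pCons a p) i *\<^sub>C (blinfun_apply T ^^ i) x)"
    unfolding poly_op_apply
    by (rule sum.mono_neutral_left) (auto simp: degree_pCons_eq_if coeff_eq_0)
  also have "\<dots> = a *\<^sub>C x + T (poly_op p T x)"
    by (subst sum.atMost_Suc_shift)
      (simp add: poly_op_apply blinfun.sum_right bounded_ops_scaleC[OF T])
  finally show ?thesis .
qed

context
  fixes T :: "'a::complex_hilbert \<Rightarrow>\<^sub>L 'a"
  assumes T: "T \<in> bounded_ops"
begin

lemma poly_op_bounded_ops: "poly_op p T \<in> bounded_ops"
proof (induction p)
  case (pCons a p)
  then show ?case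
    by (simp add: bounded_ops_def poly_op_pCons[OF T] scaleC_add_right
        scaleC_scaleC mult.commute bounded_ops_scaleC[OF T])
qed (simp add: bounded_ops_def)

lemma poly_op_commute: "poly_op p T (T x) = T (poly_op p T x)"
  by (induction p)
    (simp_all add: poly_op_pCons[OF T] blinfun.add_right bounded_ops_scaleC[OF T])

lemma poly_op_add: "poly_op (p + q) T = poly_op p T + poly_op q T"
proof (rule blinfun_eqI)
  show "poly_op (p + q) T x = (poly_op p T + poly_op q T) x" for x
    by (induction p q rule: poly_induct2)
      (simp_all add: poly_op_pCons[OF T] blinfun.add_left blinfun.add_right scaleC_add_left)
qed

lemma poly_op_smult: "poly_op (smult c p) T = scaleC_op c (poly_op p T)"
proof (rule blinfun_eqI)
  show "poly_op (smult c p) T x = scaleC_op c (poly_op p T) x" for x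
    by (induction p)
      (simp_all add: poly_op_pCons[OF T] scaleC_add_right scaleC_scaleC bounded_ops_scaleC[OF T])
qed

lemma poly_op_minus: "poly_op (- p) T = - poly_op p T"
  using poly_op_add[of "- p" p] by (simp add: eq_neg_iff_add_eq_0)

lemma poly_op_diff: "poly_op (p - q) T = poly_op p T - poly_op q T"
  using poly_op_add[of p "- q"] by (simp add: poly_op_minus)

lemma poly_op_mult: "poly_op (p * q) T = poly_op p T o\<^sub>L poly_op q T"
proof (rule blinfun_eqI)
  show "poly_op (p * q) T x = (poly_op p T o\<^sub>L poly_op q T) x" for x
    by (induction p)
      (simp_all add: poly_op_pCons[OF T] poly_op_add poly_op_smult blinfun.add_left)
qed

lemma poly_op_const: "poly_op [:a:] T = scaleC_op a id_blinfun"
  by (rule blinfun_eqI) (simp add: poly_op_pCons[OF T])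

lemma poly_op_linear: "poly_op [:a, b:] T = scaleC_op a id_blinfun + scaleC_op b T"
  by (rule blinfun_eqI)
    (simp add: poly_op_pCons[OF T] blinfun.add_left bounded_ops_scaleC[OF T])

text \<open>One half of the spectral mapping theorem. The fundamental theorem of algebra supplies a
  root z of p, which lies off the spectrum, so the factor T - z is invertible; induction on the
  degree treats the cofactor.\<close>

lemma invertible_poly_op:
  assumes "p \<noteq> 0" "\<And>z. z \<in> spectrum T \<Longrightarrow> poly p z \<noteq> 0"
  shows "invertible_op (poly_op p T)"
  using assms
proof (induction "degree p" arbitrary: p)
  case 0
  then obtain a where p: "p = [:a:]" "a \<noteq> 0"
    by (metis degree_eq_zeroE pCons_0_0)
  then have "scaleC_op (1 / a) id_blinfun o\<^sub>L poly_op p T = id_blinfun"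
    "poly_op p T o\<^sub>L scaleC_op (1 / a) id_blinfun = id_blinfun"
    by (auto simp: blinfun_ext_iff poly_op_const scaleC_scaleC)
  then show ?case
    unfolding invertible_op_def using scaleC_op_bounded_ops id_bounded_ops by blast
next
  case (Suc n)
  then have "\<not> constant (poly p)"
    by (simp add: constant_degree)
  then obtain z where "poly p z = 0"
    using fundamental_theorem_of_algebra by blast
  then obtain q where p: "p = [:- z, 1:] * q"
    by (metis dvdE poly_eq_0_iff_dvd)
  have "q \<noteq> 0"
    using Suc.prems p by auto
  then have "degree p = Suc (degree q)"
    unfolding p by (subst degree_mult_eq) auto
  then have "invertible_op (poly_op q T)"
    using Suc p \<open>q \<noteq> 0\<close> by auto
  moreover have "z \<notin> spectrum T"
    using Suc.prems(2) \<open>poly p z = 0\<close> by auto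
  moreover have "poly_op [:- z, 1:] T = T - scaleC_op z id_blinfun"
    by (rule blinfun_eqI)
      (simp add: poly_op_linear blinfun.add_left blinfun.diff_left scaleC_minus_left)
  ultimately show ?case
    unfolding p poly_op_mult by (auto simp: spectrum_iff intro: invertible_op_compose)
qed

end

section \<open>Bounds for polynomials of an operator from bounds on the spectrum\<close>

lemma poly_op_adjoint:
  assumes "selfadjoint_op T"
  shows "cinner (poly_op p T x) y = cinner x (poly_op (map_poly cnj p) T y)"
proof -
  note T = selfadjoint_op_bounded_ops[OF assms]
  show ?thesis
    by (induction p arbitrary: x y)
      (simp_all add: poly_op_pCons[OF T] cinner_simps map_poly_pCons
        selfadjoint_op_cinner[OF assms] poly_op_commute[OF T])
qed

lemma selfadjoint_poly_op:
  "selfadjoint_op T \<Longrightarrow> map_poly cnj p = p \<Longrightarrow> selfadjoint_op (poly_op p T)"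
  using poly_op_adjoint[of T p]
  by (simp add: selfadjoint_op_def poly_op_bounded_ops selfadjoint_op_bounded_ops)

text \<open>A test for real coefficients by values: a complex polynomial is determined by its
  values, and \<open>map_poly cnj p\<close> takes the value \<open>cnj (poly p (cnj z))\<close> at
  z.\<close>

lemma map_poly_cnj_eqI: "(\<And>z. cnj (poly p (cnj z)) = poly p z) \<Longrightarrow> map_poly cnj p = p"
  by (simp add: poly_eq_poly_eq_iff[symmetric] fun_eq_iff)

text \<open>The infimum m of the numerical range of p(T) is a value of p on the spectrum, since
  otherwise p(T) - m would be invertible. Therefore c <= m.\<close>

lemma poly_op_ge:
  assumes T: "selfadjoint_op T" and pT: "selfadjoint_op (poly_op p T)"
    and c: "\<And>z. z \<in> spectrum T \<Longrightarrow> c \<le> Re (poly p z)"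
  shows "c * (norm x)\<^sup>2 \<le> Re (cinner (poly_op p T x) x)"
proof (cases "x = 0")
  case False
  note T' = selfadjoint_op_bounded_ops[OF T]
  obtain m where m: "\<And>x. m * (norm x)\<^sup>2 \<le> Re (cinner (poly_op p T x) x)"
    and ninv: "\<not> invertible_op (poly_op p T - m *\<^sub>R id_blinfun)"
    using selfadjoint_op_inf_spectrum[OF pT False] by blast
  \<comment> \<open>If p is the constant m, \<open>invertible_poly_op\<close> does not apply; every
    spectral point then has p(z) = m, and t shows that there is one.\<close>
  obtain t where "\<not> invertible_op (T - t *\<^sub>R id_blinfun)"
    using selfadjoint_op_inf_spectrum[OF T False] by blast
  then have t: "of_real t \<in> spectrum T"
    by (simp add: spectrum_iff scaleC_op_of_real)
  have "\<not> invertible_op (poly_op (p - [:of_real m:]) T)"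
    using ninv by (simp add: poly_op_diff[OF T'] poly_op_const[OF T'] scaleC_op_of_real)
  then have "p - [:of_real m:] = 0 \<or> (\<exists>z\<in>spectrum T. poly (p - [:of_real m:]) z = 0)"
    using invertible_poly_op[OF T'] by blast
  then obtain z where "z \<in> spectrum T" "poly p z = of_real m"
    using t by auto
  then have "c \<le> m"
    using c by fastforce
  then show ?thesis
    using m[of x] mult_right_mono[of c m "(norm x)\<^sup>2"] by simp
qed simp

text \<open>Elsewhere T - z is invertible. With D = T - Re z, a nonreal z makes the product of T - z
  and T - \<open>cnj z\<close> equal to D^2 + (Im z)^2, which is bounded below, and T - z is a
  commuting factor of it. For real z, D is bounded below if z < 0, and -D is if z >
  \<open>norm T\<close>.\<close>

lemma spectrum_positive_op:
  assumes T: "positive_op T" and z: "z \<in> spectrum T"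
  shows "Im z = 0" "0 \<le> Re z" "Re z \<le> norm T"
proof -
  note sa = positive_op_selfadjoint[OF T]
  note T' = selfadjoint_op_bounded_ops[OF sa]
  show Im: "Im z = 0"
  proof (rule ccontr)
    assume ne: "Im z \<noteq> 0"
    define D where "D = T - Re z *\<^sub>R id_blinfun"
    define N where "N = (D o\<^sub>L D) + (Im z)\<^sup>2 *\<^sub>R id_blinfun"
    define S where "S w = T - scaleC_op w id_blinfun" for w
    have D: "selfadjoint_op D"
      unfolding D_def by (rule selfadjoint_op_diff_scaleR[OF sa])
    have "complex_of_real (Re z) + \<i> * Im z = z" "complex_of_real (Re z) - \<i> * Im z = cnj z"
      by (simp_all add: complex_eq_iff)
    then have S_apply: "S z x = D x - (\<i> * Im z) *\<^sub>C x" "S (cnj z) x = D x + (\<i> * Im z) *\<^sub>C x" for x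
      using scaleC_add_left[of "Re z" "\<i> * Im z" x] scaleC_add_left[of "Re z" "- (\<i> * Im z)" x]
      by (simp_all add: S_def D_def blinfun.diff_left blinfun.scaleR_left scaleR_scaleC scaleC_minus_left)
    have S: "S z o\<^sub>L S (cnj z) = N" "S (cnj z) o\<^sub>L S z = N"
      by (auto intro!: blinfun_eqI simp: S_apply N_def blinfun.add_left blinfun.diff_right
          blinfun.add_right blinfun.scaleR_left scaleR_scaleC scaleC_add_right
          bounded_ops_scaleC[OF selfadjoint_op_bounded_ops[OF D]]
          scaleC_diff_right scaleC_scaleC scaleC_minus_left power2_eq_square algebra_simps)
    have "N \<in> bounded_ops"
      unfolding N_def using selfadjoint_op_bounded_ops[OF D]
      by (auto intro!: add_bounded_ops compose_bounded_ops scaleC_op_bounded_ops id_bounded_ops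
          simp flip: scaleC_op_of_real)
    then have "selfadjoint_op N"
      by (auto simp: selfadjoint_op_def N_def blinfun.add_left blinfun.scaleR_left cinner_simps
          selfadjoint_op_cinner[OF D])
    moreover have "(Im z)\<^sup>2 * (norm x)\<^sup>2 \<le> Re (cinner (N x) x)" for x
      by (simp add: N_def blinfun.add_left blinfun.scaleR_left cinner_simps
          selfadjoint_op_cinner[OF D, of "D x"] Re_cinner_self)
    ultimately have "invertible_op N"
      using ne by (intro invertible_op_bounded_below[where c = "(Im z)\<^sup>2"]) auto
    moreover have "S (cnj z) \<in> bounded_ops"
      unfolding S_def by (intro diff_bounded_ops T' scaleC_op_bounded_ops id_bounded_ops)
    ultimately have "invertible_op (S z)"
      using invertible_op_factor[of "S z" "S (cnj z)"] S by simp
    then show False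
      using z by (simp add: spectrum_iff S_def)
  qed
  define D where "D = T - Re z *\<^sub>R id_blinfun"
  have ninv: "\<not> invertible_op D"
    using z Im by (metis D_def complex_is_Real_iff of_real_Re scaleC_op_of_real spectrum_iff)
  have D: "selfadjoint_op D"
    unfolding D_def by (rule selfadjoint_op_diff_scaleR[OF sa])
  have D_cinner: "Re (cinner (D x) x) = Re (cinner (T x) x) - Re z * (norm x)\<^sup>2" for x
    by (simp add: D_def blinfun.diff_left blinfun.scaleR_left cinner_simps Re_cinner_self)
  show "0 \<le> Re z"
  proof (rule ccontr)
    assume "\<not> 0 \<le> Re z"
    then have "invertible_op D"
      using positive_op_Re_nonneg[OF T]
      by (intro invertible_op_bounded_below[OF D, where c = "- Re z"]) (auto simp: D_cinner)
    then show False
      using ninv by simp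
  qed
  show "Re z \<le> norm T"
  proof (rule ccontr)
    assume "\<not> Re z \<le> norm T"
    moreover have "selfadjoint_op (- D)"
      using D by (auto simp: selfadjoint_op_def bounded_ops_def blinfun.minus_left
          cinner_minus_left cinner_minus_right simp flip: scaleC_minus_left)
        (metis scaleC_minus_left scaleC_diff_right diff_0 scaleC_zero_right)
    moreover have "(Re z - norm T) * (norm x)\<^sup>2 \<le> Re (cinner ((- D) x) x)" for x
      using Re_cinner_le_norm[of T x]
      by (simp add: blinfun.minus_left cinner_minus_left D_cinner left_diff_distrib)
    ultimately have "invertible_op (- D)"
      by (intro invertible_op_bounded_below[where c = "Re z - norm T"]) auto
    then show False
      using ninv invertible_op_uminus by blast
  qed
qed

text \<open>The squared norm of p(T) x is the quadratic form at x of the conjugate polynomial times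
  p. On the real spectrum this product has the values |p|^2; negating it turns the upper bound M^2
  into the lower bound that \<open>poly_op_ge\<close> expects.\<close>

lemma norm_poly_op_le:
  assumes T: "positive_op T" and M: "0 \<le> M" "\<And>z. z \<in> spectrum T \<Longrightarrow> cmod (poly p z) \<le> M"
  shows "norm (poly_op p T) \<le> M"
proof (rule norm_blinfun_bound[OF M(1)])
  fix x
  note sa = positive_op_selfadjoint[OF T]
  note T' = selfadjoint_op_bounded_ops[OF sa]
  let ?p' = "map_poly cnj p"
  let ?q = "- (?p' * p)"
  have "cinner (poly_op ?p' T (poly_op p T x)) x = cinner (poly_op p T x) (poly_op p T x)"
    by (subst poly_op_adjoint[OF sa]) (simp add: map_poly_map_poly o_def)
  then have "Re (cinner (poly_op ?q T x) x) = - (norm (poly_op p T x))\<^sup>2"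
    by (simp add: poly_op_minus[OF T'] poly_op_mult[OF T'] blinfun.minus_left
        cinner_minus_left Re_cinner_self)
  moreover have "- (M\<^sup>2) * (norm x)\<^sup>2 \<le> Re (cinner (poly_op ?q T x) x)"
  proof (rule poly_op_ge[OF sa])
    show "selfadjoint_op (poly_op ?q T)"
      by (intro selfadjoint_poly_op sa map_poly_cnj_eqI) (simp add: mult.commute)
    show "- (M\<^sup>2) \<le> Re (poly ?q z)" if "z \<in> spectrum T" for z
    proof -
      have "cnj z = z"
        using spectrum_positive_op(1)[OF T that] by (simp add: complex_eq_iff)
      then have "Re (poly ?q z) = - ((cmod (poly p z))\<^sup>2)"
        by (simp add: cmod_power2) (simp add: power2_eq_square)
      then show ?thesis
        using M(2)[OF that] by (simp add: power_mono)
    qed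
  qed
  ultimately have "(norm (poly_op p T x))\<^sup>2 \<le> (M * norm x)\<^sup>2"
    by (simp add: power_mult_distrib)
  then show "norm (poly_op p T x) \<le> M * norm x"
    by (rule power2_le_imp_le) (simp add: M(1))
qed

section \<open>Continuous functional calculus\<close>

lemma Cauchy_poly_op:
  assumes T: "positive_op T" and p: "uniform_limit (spectrum T) (\<lambda>n. poly (p n)) f sequentially"
  shows "Cauchy (\<lambda>n. poly_op (p n) T)"
proof (rule metric_CauchyI)
  fix e :: real
  assume "0 < e"
  \<comment> \<open>Two errors of e / 4 add up to e / 2, which leaves room for the strict inequality
    after the non-strict \<open>norm_poly_op_le\<close>.\<close>
  then have "\<forall>\<^sub>F n in sequentially. \<forall>z\<in>spectrum T. dist (poly (p n) z) (f z) < e / 4"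
    using uniform_limitD[OF p, of "e / 4"] by simp
  then obtain N where N: "\<And>n z. n \<ge> N \<Longrightarrow> z \<in> spectrum T \<Longrightarrow> dist (poly (p n) z) (f z) < e / 4"
    by (auto simp: eventually_sequentially)
  have "dist (poly_op (p m) T) (poly_op (p n) T) < e" if "m \<ge> N" "n \<ge> N" for m n
  proof -
    have "norm (poly_op (p m - p n) T) \<le> e / 2"
    proof (rule norm_poly_op_le[OF T])
      fix z
      assume z: "z \<in> spectrum T"
      have "dist (poly (p m) z) (poly (p n) z) \<le> e / 2"
        using N[OF that(1) z] N[OF that(2) z]
          dist_triangle2[of "poly (p m) z" "poly (p n) z" "f z"] by simp
      then show "cmod (poly (p m - p n) z) \<le> e / 2"
        by (simp add: dist_norm)
    qed (use \<open>0 < e\<close> in simp)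
    then show ?thesis
      using \<open>0 < e\<close> T
      by (simp add: dist_norm poly_op_diff positive_op_def)
  qed
  then show "\<exists>M. \<forall>m\<ge>M. \<forall>n\<ge>M. dist (poly_op (p m) T) (poly_op (p n) T) < e"
    by blast
qed

text \<open>Makes the limit of p_n(T) independent of the approximating sequence.\<close>

lemma poly_op_diff_tendsto_0:
  assumes T: "positive_op T" and p: "uniform_limit (spectrum T) (\<lambda>n. poly (p n)) f sequentially"
    and q: "uniform_limit (spectrum T) (\<lambda>n. poly (q n)) f sequentially"
  shows "(\<lambda>n. poly_op (q n) T - poly_op (p n) T) \<longlonglongrightarrow> 0"
proof (rule tendstoI)
  fix e :: real
  assume e: "0 < e"
  have "uniform_limit (spectrum T) (\<lambda>n z. poly (q n) z - poly (p n) z) (\<lambda>z. f z - f z) sequentially"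
    by (intro uniform_limit_intros p q)
  then have "\<forall>\<^sub>F n in sequentially. \<forall>z\<in>spectrum T. cmod (poly (q n - p n) z) < e / 2"
    using e uniform_limitD[of _ _ _ _ "e / 2"] by (fastforce simp: dist_norm)
  then show "\<forall>\<^sub>F n in sequentially. dist (poly_op (q n) T - poly_op (p n) T) 0 < e"
  proof eventually_elim
    case (elim n)
    then have "norm (poly_op (q n - p n) T) \<le> e / 2"
      using e by (intro norm_poly_op_le[OF T]) (auto simp: less_imp_le)
    then show ?case
      using e T by (simp add: poly_op_diff positive_op_def)
  qed
qed

text \<open>Resolves the definite description: completeness gives a limit S along p, every other
  approximating sequence has the same limit, and a competing operator must agree with S along
  p.\<close>

lemma cont_fun_calc_tendsto:
  assumes T: "positive_op T" and p: "uniform_limit (spectrum T) (\<lambda>n. poly (p n)) f sequentially"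
  shows "(\<lambda>n. poly_op (p n) T) \<longlonglongrightarrow> cont_fun_calc f T"
proof -
  have bo: "T \<in> bounded_ops"
    using T by (simp add: positive_op_def)
  obtain S where S: "(\<lambda>n. poly_op (p n) T) \<longlonglongrightarrow> S"
    using Cauchy_poly_op[OF T p] by (auto simp: Cauchy_convergent_iff convergent_def)
  have "cont_fun_calc f T = S"
    unfolding cont_fun_calc_def
  proof (rule the_equality)
    have "(\<lambda>n. poly_op (q n) T) \<longlonglongrightarrow> S"
      if q: "uniform_limit (spectrum T) (\<lambda>n. poly (q n)) f sequentially" for q
      using tendsto_add[OF poly_op_diff_tendsto_0[OF T p q] S] by simp
    moreover have "S \<in> bounded_ops"
      using bounded_ops_limit[OF poly_op_bounded_ops[OF bo] S] .
    ultimately show "S \<in> bounded_ops \<and>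
        (\<forall>p. uniform_limit (spectrum T) (\<lambda>n. poly (p n)) f sequentially
          \<longrightarrow> (\<lambda>n. poly_op (p n) T) \<longlonglongrightarrow> S)"
      by blast
    show "S' = S" if "S' \<in> bounded_ops \<and>
        (\<forall>p. uniform_limit (spectrum T) (\<lambda>n. poly (p n)) f sequentially
          \<longrightarrow> (\<lambda>n. poly_op (p n) T) \<longlonglongrightarrow> S')" for S'
      using that p S LIMSEQ_unique by blast
  qed
  then show ?thesis
    using S by simp
qed

section \<open>Polynomial approximation of powers, and the square root\<close>

lemma Weierstrass_poly:
  fixes g :: "real \<Rightarrow> real"
  assumes "continuous_on {a..b} g" "0 < e"
  obtains p where "map_poly cnj p = p" "\<And>t. t \<in> {a..b} \<Longrightarrow> cmod (poly p (of_real t) - of_real (g t)) < e"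
proof -
  obtain h where h: "real_polynomial_function h" "\<And>t. t \<in> {a..b} \<Longrightarrow> \<bar>g t - h t\<bar> < e"
    using Stone_Weierstrass_real_polynomial_function[OF compact_Icc assms] by blast
  then obtain c n where c: "h = (\<lambda>t. \<Sum>i\<le>n. c i * t ^ i)"
    by (auto simp: real_polynomial_function_iff_sum)
  \<comment> \<open>The coefficients come from a real polynomial, so that p(T) is self-adjoint for
    self-adjoint T; \<open>map_poly cnj p = p\<close> records this.\<close>
  let ?p = "\<Sum>i\<le>n. monom (complex_of_real (c i)) i"
  have poly: "poly ?p z = (\<Sum>i\<le>n. of_real (c i) * z ^ i)" for z
    by (simp add: poly_sum poly_monom)
  have "cmod (poly ?p (of_real t) - of_real (g t)) < e" if "t \<in> {a..b}" for t
  proof -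
    have "poly ?p (of_real t) - of_real (g t) = complex_of_real (h t - g t)"
      by (simp add: poly c)
    then show ?thesis
      using h(2)[OF that] by (simp only: norm_of_real)
  qed
  moreover have "map_poly cnj ?p = ?p"
    by (rule map_poly_cnj_eqI) (simp add: poly)
  ultimately show thesis
    using that by blast
qed

lemma op_powr_approx:
  assumes T: "positive_op T" and s: "0 < s"
  obtains p where "\<And>n. map_poly cnj (p n) = p n"
    and "uniform_limit (spectrum T) (\<lambda>n. poly (p n)) (\<lambda>z. of_real (Re z powr s)) sequentially"
    and "(\<lambda>n. poly_op (p n) T) \<longlonglongrightarrow> T powr\<^sub>o\<^sub>p s"
proof -
  have "continuous_on {0..norm T} (\<lambda>t. t powr s)"
    using s by (intro continuous_on_powr') (auto intro: continuous_intros)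
  \<comment> \<open>The spectrum lies in the interval from 0 to \<open>norm T\<close>, so
    approximation there suffices.\<close>
  then have "\<exists>p. map_poly cnj p = p \<and> (\<forall>t\<in>{0..norm T}.
      cmod (poly p (of_real t) - of_real (t powr s)) < inverse (real (Suc n)))" for n
    by (rule Weierstrass_poly[where e = "inverse (real (Suc n))"]) auto
  then obtain p where p: "\<And>n. map_poly cnj (p n) = p n"
      "\<And>n t. t \<in> {0..norm T} \<Longrightarrow>
        cmod (poly (p n) (of_real t) - of_real (t powr s)) < inverse (real (Suc n))"
    by metis
  have "uniform_limit (spectrum T) (\<lambda>n. poly (p n)) (\<lambda>z. of_real (Re z powr s)) sequentially"
  proof (rule uniform_limitI)
    fix e :: real
    assume "0 < e"
    with LIMSEQ_inverse_real_of_nat have "\<forall>\<^sub>F n in sequentially. inverse (real (Suc n)) < e"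
      by (rule order_tendstoD)
    then show "\<forall>\<^sub>F n in sequentially. \<forall>z\<in>spectrum T. dist (poly (p n) z) (of_real (Re z powr s)) < e"
    proof eventually_elim
      case (elim n)
      show ?case
      proof
        fix z
        assume "z \<in> spectrum T"
        note spectrum_positive_op[OF T this]
        then have "of_real (Re z) = z" "Re z \<in> {0..norm T}"
          by (auto simp: complex_eq_iff)
        then show "dist (poly (p n) z) (of_real (Re z powr s)) < e"
          using p(2)[of "Re z" n] elim by (simp add: dist_norm)
      qed
    qed
  qed
  moreover from this have "(\<lambda>n. poly_op (p n) T) \<longlonglongrightarrow> T powr\<^sub>o\<^sub>p s"
    unfolding op_powr_def by (rule cont_fun_calc_tendsto[OF T])
  ultimately show thesis
    using that p(1) by blast
qed

lemma selfadjoint_op_powr: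
  assumes T: "positive_op T" and s: "0 < s"
  shows "selfadjoint_op (T powr\<^sub>o\<^sub>p s)"
proof -
  obtain p where p: "\<And>n. map_poly cnj (p n) = p n"
    and lim: "(\<lambda>n. poly_op (p n) T) \<longlonglongrightarrow> T powr\<^sub>o\<^sub>p s"
    using op_powr_approx[OF T s] by blast
  show ?thesis
    by (rule selfadjoint_op_limit[OF _ lim]) (intro selfadjoint_poly_op positive_op_selfadjoint T p)
qed

text \<open>If p_n tends to the square root uniformly on the spectrum, then p_n^2 tends to the
  identity function, so p_n(T)^2 converges both to the squared root of T and to T.\<close>

lemma op_powr_half_compose:
  assumes T: "positive_op T"
  shows "T powr\<^sub>o\<^sub>p (1/2) o\<^sub>L T powr\<^sub>o\<^sub>p (1/2) = T"
proof -
  have bo: "T \<in> bounded_ops"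
    using T by (simp add: positive_op_def)
  let ?f = "\<lambda>z::complex. complex_of_real (Re z powr (1/2))"
  obtain p where p: "uniform_limit (spectrum T) (\<lambda>n. poly (p n)) ?f sequentially"
    and lim: "(\<lambda>n. poly_op (p n) T) \<longlonglongrightarrow> T powr\<^sub>o\<^sub>p (1/2)"
    using op_powr_approx[OF T, of "1/2"] by auto
  \<comment> \<open>Uniform convergence passes to products when the limit functions are
    bounded.\<close>
  have "bounded (?f ` spectrum T)"
    unfolding bounded_iff using spectrum_positive_op[OF T]
    by (auto intro!: exI[of _ "norm T powr (1/2)"] powr_mono2)
  then have "uniform_limit (spectrum T) (\<lambda>n z. poly (p n) z * poly (p n) z) (\<lambda>z. ?f z * ?f z) sequentially"
    using p by (intro uniform_lim_mult)
  also have "?this \<longleftrightarrow> uniform_limit (spectrum T) (\<lambda>n. poly (p n * p n)) (\<lambda>z. z) sequentially"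
    using spectrum_positive_op[OF T]
    by (intro uniform_limit_cong') (auto simp: complex_eq_iff powr_half_sqrt simp flip: of_real_mult)
  finally have sq: "uniform_limit (spectrum T) (\<lambda>n. poly (p n * p n)) (\<lambda>z. z) sequentially" .
  have "(\<lambda>n. poly_op (p n * p n) T) \<longlonglongrightarrow> (T powr\<^sub>o\<^sub>p (1/2) o\<^sub>L T powr\<^sub>o\<^sub>p (1/2))"
    unfolding poly_op_mult[OF bo]
    by (rule bounded_bilinear.tendsto[OF bounded_bilinear_blinfun_compose lim lim])
  moreover have "(\<lambda>n. poly_op (p n * p n) T) \<longlonglongrightarrow> T"
  proof -
    \<comment> \<open>The constant sequence \<open>[:0, 1:]\<close> also approximates the identity
      function, so p_n^2(T) has the same limit as this sequence, namely T.\<close>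
    have "poly_op [:0, 1:] T = T"
      by (rule blinfun_eqI) (simp add: poly_op_linear[OF bo] blinfun.add_left)
    moreover have "uniform_limit (spectrum T) (\<lambda>n. poly [:0, 1:]) (\<lambda>z. z) sequentially"
      by (rule uniform_limitI) simp
    ultimately show ?thesis
      using poly_op_diff_tendsto_0[OF T _ sq, of "\<lambda>n. [:0, 1:]"] by (simp add: LIM_zero_iff)
  qed
  ultimately show ?thesis
    by (rule LIMSEQ_unique)
qed

lemma norm_op_powr_half:
  assumes T: "positive_op T"
  shows "(norm ((T powr\<^sub>o\<^sub>p (1/2)) x))\<^sup>2 = Re (cinner (T x) x)"
proof -
  let ?S = "T powr\<^sub>o\<^sub>p (1/2)"
  have "cinner (?S x) (?S x) = cinner (?S (?S x)) x"
    using selfadjoint_op_cinner[OF selfadjoint_op_powr[OF T], of "1/2" "?S x" x] by simp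
  also have "?S (?S x) = T x"
    using op_powr_half_compose[OF T] by (simp add: blinfun_ext_iff)
  finally show ?thesis
    by (simp flip: Re_cinner_self)
qed

section \<open>Tangent line bounds for powers\<close>

lemma powr_ge_tangent:
  fixes t l r :: real
  assumes "0 \<le> t" "0 \<le> l" "1 < r"
  shows "r * l powr (r - 1) * t - (r - 1) * l powr r \<le> t powr r"
\<comment> \<open>Convexity and the derivative are used on the open half-line, so boundary points
  are separate; at l = 0 the left-hand side vanishes because
  \<open>0 powr (r - 1) = 0\<close>.\<close>
proof (cases "l = 0 \<or> t = 0")
  case True
  then show ?thesis
    using assms by auto
next
  case False
  have "r * l powr (r - 1) * (t - l) \<le> t powr r - l powr r"
  proof (rule convex_on_imp_above_tangent[where A = "{0<..}"])
    show "convex_on {0<..} (\<lambda>x. x powr r)"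
      using powr_convex assms by simp
    show "((\<lambda>x. x powr r) has_real_derivative r * l powr (r - 1)) (at l within {0<..})"
      using False assms by (auto intro!: derivative_eq_intros)
  qed (use False assms in \<open>auto simp: interior_open\<close>)
  moreover have "r * (l powr (r - 1) * l) = r * l powr r"
    using False assms by (simp add: powr_diff)
  ultimately show ?thesis
    unfolding right_diff_distrib left_diff_distrib by (simp add: mult.assoc)
qed

text \<open>The approximants p_n eventually exceed the tangent line L minus e on the spectrum.
  \<open>poly_op_ge\<close> transfers this to operators; then n tends to infinity and e to
  0.\<close>

lemma op_powr_ge_tangent:
  assumes T: "positive_op T" and r: "1 < r" and l: "0 \<le> l"
  shows "r * l powr (r - 1) * Re (cinner (T x) x) - (r - 1) * l powr r * (norm x)\<^sup>2
      \<le> Re (cinner ((T powr\<^sub>o\<^sub>p r) x) x)"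
proof -
  note sa = positive_op_selfadjoint[OF T]
  note bo = selfadjoint_op_bounded_ops[OF sa]
  define a where "a = r * l powr (r - 1)"
  define b where "b = (r - 1) * l powr r"
  let ?L = "[: - of_real b, of_real a :] :: complex poly"
  obtain p where p: "\<And>n. map_poly cnj (p n) = p n"
      "uniform_limit (spectrum T) (\<lambda>n. poly (p n)) (\<lambda>z. of_real (Re z powr r)) sequentially"
      "(\<lambda>n. poly_op (p n) T) \<longlonglongrightarrow> T powr\<^sub>o\<^sub>p r"
    using op_powr_approx[OF T, of r] r by auto
  have L: "Re (cinner (poly_op ?L T x) x) = a * Re (cinner (T x) x) - b * (norm x)\<^sup>2"
    by (simp add: poly_op_linear[OF bo] blinfun.add_left cinner_simps Re_cinner_self)
  have bound: "- (e * (norm x)\<^sup>2) \<le> Re (cinner ((T powr\<^sub>o\<^sub>p r) x) x) - Re (cinner (poly_op ?L T x) x)"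
    if e: "0 < e" for e
  proof (rule tendsto_lowerbound)
    show "(\<lambda>n. Re (cinner (poly_op (p n) T x) x) - Re (cinner (poly_op ?L T x) x))
        \<longlonglongrightarrow> Re (cinner ((T powr\<^sub>o\<^sub>p r) x) x) - Re (cinner (poly_op ?L T x) x)"
      by (intro tendsto_intros tendsto_cinner_left tendsto_blinfun_apply p(3))
    show "\<forall>\<^sub>F n in sequentially. - (e * (norm x)\<^sup>2)
        \<le> Re (cinner (poly_op (p n) T x) x) - Re (cinner (poly_op ?L T x) x)"
      using uniform_limitD[OF p(2) e]
    proof eventually_elim
      case (elim n)
      have "- e * (norm x)\<^sup>2 \<le> Re (cinner (poly_op (p n - ?L) T x) x)"
      proof (rule poly_op_ge[OF sa])
        have "cnj (poly (p n) (cnj z)) = poly (p n) z" for z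
          using p(1)[of n] poly_map_poly_cnj[of "p n" z] by simp
        then show "selfadjoint_op (poly_op (p n - ?L) T)"
          by (intro selfadjoint_poly_op sa map_poly_cnj_eqI) simp
        fix z
        assume z: "z \<in> spectrum T"
        have "Re (poly ?L z) \<le> Re z powr r"
          using powr_ge_tangent[OF _ l r, of "Re z"] spectrum_positive_op[OF T z]
          by (simp add: a_def b_def algebra_simps)
        moreover have "\<bar>Re (poly (p n) z) - Re z powr r\<bar> < e"
          using elim z abs_Re_le_cmod[of "poly (p n) z - of_real (Re z powr r)"]
          by (fastforce simp: dist_norm)
        ultimately show "- e \<le> Re (poly (p n - ?L) z)"
          by simp
      qed
      then show ?case
        by (simp add: poly_op_diff[OF bo] blinfun.diff_left cinner_diff_left)
    qed
  qed simp
  have "Re (cinner (poly_op ?L T x) x) \<le> Re (cinner ((T powr\<^sub>o\<^sub>p r) x) x) + e" if "0 < e" for e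
  proof -
    \<comment> \<open>Dividing by (norm x)^2 + 1 absorbs the factor (norm x)^2 of
      \<open>bound\<close> and also covers x = 0.\<close>
    have "e / ((norm x)\<^sup>2 + 1) * (norm x)\<^sup>2 \<le> e"
      using that by (simp add: field_simps add_pos_nonneg)
    then show ?thesis
      using bound[of "e / ((norm x)\<^sup>2 + 1)"] that by (auto simp: add_nonneg_pos)
  qed
  then have "Re (cinner (poly_op ?L T x) x) \<le> Re (cinner ((T powr\<^sub>o\<^sub>p r) x) x)"
    by (rule field_le_epsilon)
  then show ?thesis
    unfolding L by (simp add: a_def b_def)
qed

section \<open>Numerical radius\<close>

lemma bdd_above_numerical_range:
  fixes T :: "'a::complex_hilbert \<Rightarrow>\<^sub>L 'a"
  shows "bdd_above (insert 0 {cmod (cinner (T x) x) | x. norm x = 1})"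
proof (rule bdd_aboveI)
  fix t
  assume "t \<in> insert 0 {cmod (cinner (T x) x) | x. norm x = 1}"
  then consider "t = 0" | x where "norm x = 1" "t = cmod (cinner (T x) x)"
    by auto
  then show "t \<le> norm T"
  proof cases
    case 2
    then show ?thesis
      using cmod_cinner_le[of "T x" x] norm_blinfun[of T x] by simp
  qed simp
qed

lemma numerical_radius_nonneg: "0 \<le> numerical_radius T"
  unfolding numerical_radius_def by (rule cSup_upper[OF _ bdd_above_numerical_range]) simp

lemma cmod_cinner_le_numerical_radius:
  "norm x = 1 \<Longrightarrow> cmod (cinner (blinfun_apply T x) x) \<le> numerical_radius T"
  unfolding numerical_radius_def by (rule cSup_upper[OF _ bdd_above_numerical_range]) auto

lemma numerical_radius_least:
  assumes "0 \<le> c" "\<And>x. norm x = 1 \<Longrightarrow> cmod (cinner (blinfun_apply T x) x) \<le> c"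
  shows "numerical_radius T \<le> c"
  unfolding numerical_radius_def by (rule cSup_least) (use assms in auto)

lemma numerical_radius_le_norm:
  fixes T :: "'a::complex_hilbert \<Rightarrow>\<^sub>L 'a"
  shows "numerical_radius T \<le> norm T"
proof (rule numerical_radius_least)
  fix x :: 'a
  assume "norm x = 1"
  then show "cmod (cinner (T x) x) \<le> norm T"
    using cmod_cinner_le[of "T x" x] norm_blinfun[of T x] by simp
qed simp

lemma numerical_radius_add:
  fixes S T :: "'a::complex_hilbert \<Rightarrow>\<^sub>L 'a"
  shows "numerical_radius (S + T) \<le> numerical_radius S + numerical_radius T"
proof (rule numerical_radius_least)
  fix x :: 'a
  assume x: "norm x = 1"
  have "cmod (cinner ((S + T) x) x) \<le> cmod (cinner (S x) x) + cmod (cinner (T x) x)"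
    by (simp add: blinfun.add_left cinner_add_left norm_triangle_ineq)
  also have "\<dots> \<le> numerical_radius S + numerical_radius T"
    by (intro add_mono cmod_cinner_le_numerical_radius x)
  finally show "cmod (cinner ((S + T) x) x) \<le> numerical_radius S + numerical_radius T" .
qed (simp add: numerical_radius_nonneg)

lemma numerical_radius_scaleR_le:
  fixes T :: "'a::complex_hilbert \<Rightarrow>\<^sub>L 'a"
  assumes "0 \<le> a"
  shows "numerical_radius (a *\<^sub>R T) \<le> a * numerical_radius T"
proof (rule numerical_radius_least)
  fix x :: 'a
  assume "norm x = 1"
  then show "cmod (cinner ((a *\<^sub>R T) x) x) \<le> a * numerical_radius T"
    using assms cmod_cinner_le_numerical_radius[of x T]
    by (simp add: blinfun.scaleR_left cinner_simps norm_mult mult_left_mono)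
qed (simp add: assms numerical_radius_nonneg)

lemma Re_cinner_le_numerical_radius:
  fixes T :: "'a::complex_hilbert \<Rightarrow>\<^sub>L 'a"
  shows "Re (cinner (T x) x) \<le> numerical_radius T * (norm x)\<^sup>2"
proof (cases "x = 0")
  case False
  have "Re (cinner (T x) x) = (norm x)\<^sup>2 * Re (cinner (T (sgn x)) (sgn x))"
    using False
    by (simp add: sgn_div_norm blinfun.scaleR_right cinner_simps power2_eq_square field_simps)
  moreover have "Re (cinner (T (sgn x)) (sgn x)) \<le> numerical_radius T"
    using cmod_cinner_le_numerical_radius[of "sgn x" T] complex_Re_le_cmod False
    by (meson norm_sgn order_trans)
  ultimately show ?thesis
    by (simp add: mult.commute[of "numerical_radius T"] mult_left_mono)
qed simp

text \<open>The weights in each of S and T add up to 1, so S + T is the sum of the two weighted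
  operators and subadditivity applies.\<close>

lemma numerical_radius_average_le:
  "numerical_radius ((1/2) *\<^sub>R (S + T)) \<le> 1/2 *
    (numerical_radius (\<alpha> *\<^sub>R S + (1 - \<alpha>) *\<^sub>R T) + numerical_radius ((1 - \<alpha>) *\<^sub>R S + \<alpha> *\<^sub>R T))"
proof -
  have "S + T = (\<alpha> *\<^sub>R S + (1 - \<alpha>) *\<^sub>R T) + ((1 - \<alpha>) *\<^sub>R S + \<alpha> *\<^sub>R T)"
    by (simp add: algebra_simps)
  then have "numerical_radius (S + T) \<le>
      numerical_radius (\<alpha> *\<^sub>R S + (1 - \<alpha>) *\<^sub>R T) + numerical_radius ((1 - \<alpha>) *\<^sub>R S + \<alpha> *\<^sub>R T)"
    using numerical_radius_add by metis
  then show ?thesis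
    using numerical_radius_scaleR_le[of "1/2" "S + T"] by simp
qed

section \<open>Block diagonal operators\<close>

lemma block_op_diag_apply: "block_op P 0 0 S u = (P (fst u), S (snd u))"
  by (simp add: block_op.rep_eq case_prod_beta)

lemma positive_op_block_diag:
  assumes "positive_op P" "positive_op S"
  shows "positive_op (block_op P 0 0 S)"
  using assms
  by (auto simp: positive_op_def bounded_ops_def block_op_diag_apply cinner_prod_def scaleC_prod_def
      intro: nonneg_Reals_add_I)

lemma Re_cinner_block_diag:
  fixes P S :: "'a::complex_hilbert \<Rightarrow>\<^sub>L 'a"
  shows "Re (cinner (block_op P 0 0 S u) u) = Re (cinner (P (fst u)) (fst u)) + Re (cinner (S (snd u)) (snd u))"
  by (simp add: block_op_diag_apply cinner_prod_def)

lemma norm_prod_power2: "(norm u)\<^sup>2 = (norm (fst u))\<^sup>2 + (norm (snd u))\<^sup>2"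
  by (simp add: norm_prod_def)

lemma norm_block_diag_apply_le:
  fixes P S :: "'a::complex_hilbert \<Rightarrow>\<^sub>L 'a"
  shows "norm (block_op P 0 0 S u) \<le> max (norm P) (norm S) * norm u"
proof (rule power2_le_imp_le)
  let ?M = "max (norm P) (norm S)"
  have "norm (P (fst u)) \<le> ?M * norm (fst u)" "norm (S (snd u)) \<le> ?M * norm (snd u)"
    by (rule order_trans[OF norm_blinfun], rule mult_right_mono, simp_all)+
  then have "(norm (P (fst u)))\<^sup>2 + (norm (S (snd u)))\<^sup>2
      \<le> (?M * norm (fst u))\<^sup>2 + (?M * norm (snd u))\<^sup>2"
    by (intro add_mono power_mono) auto
  then show "(norm (block_op P 0 0 S u))\<^sup>2 \<le> (?M * norm u)\<^sup>2"
    by (simp add: norm_prod_power2 block_op_diag_apply power_mult_distrib distrib_left)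
qed (simp add: le_max_iff_disj)

text \<open>Taking the tangent of \<open>t \<mapsto> t\<^sup>r\<close> at \<open>l = \<langle>(P \<oplus> S) u, u\<rangle>\<close> in both blocks avoids comparing
  \<open>(P \<oplus> S)\<^sup>r\<close> with \<open>P\<^sup>r \<oplus> S\<^sup>r\<close>.\<close>

lemma McCarthy_block_diag:
  assumes P: "positive_op P" and S: "positive_op S" and r: "1 < r" and u: "norm u = 1"
  shows "Re (cinner (block_op P 0 0 S u) u) powr r
    \<le> Re (cinner ((P powr\<^sub>o\<^sub>p r) (fst u)) (fst u)) + Re (cinner ((S powr\<^sub>o\<^sub>p r) (snd u)) (snd u))"
proof -
  define l where "l = Re (cinner (block_op P 0 0 S u) u)"
  have l: "0 \<le> l"
    unfolding l_def by (intro positive_op_Re_nonneg positive_op_block_diag P S)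
  define a where "a = r * l powr (r - 1)"
  define b where "b = (r - 1) * l powr r"
  have "l powr (r - 1) * l = l powr r"
    using l by (cases "l = 0") (auto simp: powr_diff)
  then have "l powr r = a * l - b"
    by (simp add: a_def b_def algebra_simps)
  also have "\<dots> = (a * Re (cinner (P (fst u)) (fst u)) - b * (norm (fst u))\<^sup>2)
      + (a * Re (cinner (S (snd u)) (snd u)) - b * (norm (snd u))\<^sup>2)"
  proof -
    \<comment> \<open>The constant term of the tangent line is shared between the blocks in
      proportion to the squared norms of the components of the unit vector u.\<close>
    have "b = b * ((norm (fst u))\<^sup>2 + (norm (snd u))\<^sup>2)"
      using norm_prod_power2[of u] u by simp
    then show ?thesis
      by (simp add: l_def Re_cinner_block_diag algebra_simps)
  qed
  also have "\<dots> \<le> Re (cinner ((P powr\<^sub>o\<^sub>p r) (fst u)) (fst u)) + Re (cinner ((S powr\<^sub>o\<^sub>p r) (snd u)) (snd u))"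
    unfolding a_def b_def by (intro add_mono op_powr_ge_tangent P S r l)
  finally show ?thesis
    unfolding l_def .
qed

lemma Re_cinner_average_le:
  "Re (cinner (blinfun_apply S x) x) + Re (cinner (blinfun_apply T x) x)
    \<le> 2 * numerical_radius ((1/2) *\<^sub>R (S + T)) * (norm x)\<^sup>2"
  using Re_cinner_le_numerical_radius[of "(1/2) *\<^sub>R (S + T)" x]
  by (simp add: blinfun.scaleR_left blinfun.add_left cinner_simps)

lemma numerical_radius_powr_block_le:
  fixes A1 A2 B1 B2 X1 X2 :: "'a::complex_hilbert \<Rightarrow>\<^sub>L 'a"
  assumes pos: "positive_op A1" "positive_op A2" "positive_op B1" "positive_op B2" and r: "1 < r"
  shows "numerical_radius (block_op A1 0 0 A2 powr\<^sub>o\<^sub>p (1/2) o\<^sub>L block_op X1 0 0 X2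
        o\<^sub>L block_op B1 0 0 B2 powr\<^sub>o\<^sub>p (1/2)) powr r
      \<le> max (norm X1 powr r) (norm X2 powr r) *
        max (numerical_radius ((1/2) *\<^sub>R (A1 powr\<^sub>o\<^sub>p r + B1 powr\<^sub>o\<^sub>p r)))
            (numerical_radius ((1/2) *\<^sub>R (A2 powr\<^sub>o\<^sub>p r + B2 powr\<^sub>o\<^sub>p r)))"
proof -
  define A where "A = block_op A1 0 0 A2"
  define B where "B = block_op B1 0 0 B2"
  define Y where "Y = block_op X1 0 0 X2"
  define w1 where "w1 = numerical_radius ((1/2) *\<^sub>R (A1 powr\<^sub>o\<^sub>p r + B1 powr\<^sub>o\<^sub>p r))"
  define w2 where "w2 = numerical_radius ((1/2) *\<^sub>R (A2 powr\<^sub>o\<^sub>p r + B2 powr\<^sub>o\<^sub>p r))"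
  define M where "M = max (norm X1) (norm X2)"
  define T where "T = A powr\<^sub>o\<^sub>p (1/2) o\<^sub>L Y o\<^sub>L B powr\<^sub>o\<^sub>p (1/2)"
  define c where "c = max (norm X1 powr r) (norm X2 powr r) * max w1 w2"
  have A: "positive_op A" and B: "positive_op B"
    by (simp_all add: A_def B_def positive_op_block_diag pos)
  have M: "0 \<le> M" "M powr r = max (norm X1 powr r) (norm X2 powr r)"
    using powr_mono2[of r "norm X1" "norm X2"] powr_mono2[of r "norm X2" "norm X1"] r
    by (auto simp: M_def max_def)
  have c: "0 \<le> c"
    by (auto simp: c_def w1_def w2_def le_max_iff_disj numerical_radius_nonneg)
  have "cmod (cinner (T u) u) powr r \<le> c" if u: "norm u = 1" for u
  proof -
    define a where "a = Re (cinner (A u) u)"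
    define b where "b = Re (cinner (B u) u)"
    have ab: "0 \<le> a" "0 \<le> b"
      using positive_op_Re_nonneg A B by (auto simp: a_def b_def)
    let ?y = "(B powr\<^sub>o\<^sub>p (1/2)) u"
    \<comment> \<open>Moving the self-adjoint square root of A to the second argument leaves two
      vectors for Cauchy-Schwarz, with norms computed by \<open>norm_op_powr_half\<close>.\<close>
    have "cinner (T u) u = cinner (Y ?y) ((A powr\<^sub>o\<^sub>p (1/2)) u)"
      by (simp add: T_def selfadjoint_op_cinner[OF selfadjoint_op_powr[OF A]])
    then have "cmod (cinner (T u) u) \<le> norm (Y ?y) * norm ((A powr\<^sub>o\<^sub>p (1/2)) u)"
      using cmod_cinner_le by metis
    also have "\<dots> \<le> (M * norm ?y) * norm ((A powr\<^sub>o\<^sub>p (1/2)) u)"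
      unfolding Y_def M_def by (intro mult_right_mono norm_block_diag_apply_le) simp
    also have "norm ?y = sqrt b"
      unfolding b_def by (metis norm_op_powr_half B norm_ge_zero real_sqrt_unique)
    also have "norm ((A powr\<^sub>o\<^sub>p (1/2)) u) = sqrt a"
      unfolding a_def by (metis norm_op_powr_half A norm_ge_zero real_sqrt_unique)
    finally have "cmod (cinner (T u) u) powr r \<le> (M * sqrt b * sqrt a) powr r"
      using r by (intro powr_mono2) auto
    also have "\<dots> = M powr r * (sqrt (b powr r) * sqrt (a powr r))"
      using M(1) ab by (simp add: powr_mult powr_powr mult.commute mult.assoc flip: powr_half_sqrt)
    also have "\<dots> \<le> M powr r * ((b powr r + a powr r) / 2)"
      by (intro mult_left_mono arith_geo_mean_sqrt[unfolded real_sqrt_mult]) auto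
    also have "\<dots> \<le> M powr r * max w1 w2"
    proof (rule mult_left_mono)
      let ?x = "fst u" and ?z = "snd u"
      \<comment> \<open>McCarthy's inequality for A and for B, regrouped by block: A1 with B1 on
        \<open>fst u\<close>, A2 with B2 on \<open>snd u\<close>.\<close>
      have "b powr r + a powr r
          \<le> (Re (cinner ((A1 powr\<^sub>o\<^sub>p r) ?x) ?x) + Re (cinner ((B1 powr\<^sub>o\<^sub>p r) ?x) ?x))
          + (Re (cinner ((A2 powr\<^sub>o\<^sub>p r) ?z) ?z) + Re (cinner ((B2 powr\<^sub>o\<^sub>p r) ?z) ?z))"
        using McCarthy_block_diag[OF pos(1,2) r u] McCarthy_block_diag[OF pos(3,4) r u]
        by (simp add: a_def b_def A_def B_def)
      also have "\<dots> \<le> 2 * w1 * (norm ?x)\<^sup>2 + 2 * w2 * (norm ?z)\<^sup>2"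
        unfolding w1_def w2_def by (intro add_mono Re_cinner_average_le)
      also have "\<dots> \<le> 2 * max w1 w2 * (norm ?x)\<^sup>2 + 2 * max w1 w2 * (norm ?z)\<^sup>2"
        by (intro add_mono mult_right_mono) auto
      also have "\<dots> = 2 * max w1 w2"
        using norm_prod_power2[of u] u by (simp flip: distrib_left)
      finally show "(b powr r + a powr r) / 2 \<le> max w1 w2"
        by simp
    qed simp
    finally show ?thesis
      by (simp add: M(2) c_def)
  qed
  \<comment> \<open>The supremum is taken over r-th roots of the pointwise bound; the power r is
    restored afterwards.\<close>
  then have "cmod (cinner (T u) u) \<le> c powr (1 / r)" if "norm u = 1" for u
    using powr_mono2[of "1 / r" "cmod (cinner (T u) u) powr r" c] that r by (simp add: powr_powr)
  then have "numerical_radius T \<le> c powr (1 / r)"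
    by (intro numerical_radius_least) auto
  then have "numerical_radius T powr r \<le> (c powr (1 / r)) powr r"
    using r by (intro powr_mono2 numerical_radius_nonneg) auto
  then show ?thesis
    using r c by (simp add: powr_powr T_def c_def A_def B_def Y_def w1_def w2_def)
qed

theorem theorem3p39:
  fixes A1 A2 B1 B2 X1 X2 :: "'a::complex_hilbert \<Rightarrow>\<^sub>L 'a"
    and \<AA> \<BB> \<YY> :: "('a \<times> 'a) \<Rightarrow>\<^sub>L ('a \<times> 'a)"
    and r \<alpha> :: real
  assumes "positive_op A1" and "positive_op A2" and "positive_op B1" and "positive_op B2"
    and "X1 \<in> bounded_ops" and "X2 \<in> bounded_ops"
    and "\<AA> = block_op A1 0 0 A2"
    and "\<BB> = block_op B1 0 0 B2"
    and "\<YY> = block_op X1 0 0 X2"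
    and "r \<ge> 2" and "0 \<le> \<alpha>" and "\<alpha> \<le> 1"
  shows
    "numerical_radius (\<AA> powr\<^sub>o\<^sub>p (1/2) o\<^sub>L \<YY> o\<^sub>L \<BB> powr\<^sub>o\<^sub>p (1/2)) powr r
      \<le> max (norm X1 powr r) (norm X2 powr r) *
        max (numerical_radius ((1/2) *\<^sub>R (A1 powr\<^sub>o\<^sub>p r + B1 powr\<^sub>o\<^sub>p r)))
            (numerical_radius ((1/2) *\<^sub>R (A2 powr\<^sub>o\<^sub>p r + B2 powr\<^sub>o\<^sub>p r)))
     \<and>
     max (norm X1 powr r) (norm X2 powr r) *
        max (numerical_radius ((1/2) *\<^sub>R (A1 powr\<^sub>o\<^sub>p r + B1 powr\<^sub>o\<^sub>p r)))
            (numerical_radius ((1/2) *\<^sub>R (A2 powr\<^sub>o\<^sub>p r + B2 powr\<^sub>o\<^sub>p r)))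
      \<le> 1/2 * max (norm X1 powr r) (norm X2 powr r) *
        max (numerical_radius (\<alpha> *\<^sub>R (A1 powr\<^sub>o\<^sub>p r) + (1 - \<alpha>) *\<^sub>R (B1 powr\<^sub>o\<^sub>p r))
              + numerical_radius ((1 - \<alpha>) *\<^sub>R (A1 powr\<^sub>o\<^sub>p r) + \<alpha> *\<^sub>R (B1 powr\<^sub>o\<^sub>p r)))
            (numerical_radius (\<alpha> *\<^sub>R (A2 powr\<^sub>o\<^sub>p r) + (1 - \<alpha>) *\<^sub>R (B2 powr\<^sub>o\<^sub>p r))
              + numerical_radius ((1 - \<alpha>) *\<^sub>R (A2 powr\<^sub>o\<^sub>p r) + \<alpha> *\<^sub>R (B2 powr\<^sub>o\<^sub>p r)))
     \<and>
     1/2 * max (norm X1 powr r) (norm X2 powr r) *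
        max (numerical_radius (\<alpha> *\<^sub>R (A1 powr\<^sub>o\<^sub>p r) + (1 - \<alpha>) *\<^sub>R (B1 powr\<^sub>o\<^sub>p r))
              + numerical_radius ((1 - \<alpha>) *\<^sub>R (A1 powr\<^sub>o\<^sub>p r) + \<alpha> *\<^sub>R (B1 powr\<^sub>o\<^sub>p r)))
            (numerical_radius (\<alpha> *\<^sub>R (A2 powr\<^sub>o\<^sub>p r) + (1 - \<alpha>) *\<^sub>R (B2 powr\<^sub>o\<^sub>p r))
              + numerical_radius ((1 - \<alpha>) *\<^sub>R (A2 powr\<^sub>o\<^sub>p r) + \<alpha> *\<^sub>R (B2 powr\<^sub>o\<^sub>p r)))
      \<le> 1/2 * max (norm X1 powr r) (norm X2 powr r) *
        (max (norm (\<alpha> *\<^sub>R (A1 powr\<^sub>o\<^sub>p r) + (1 - \<alpha>) *\<^sub>R (B1 powr\<^sub>o\<^sub>p r)))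
             (norm (\<alpha> *\<^sub>R (A2 powr\<^sub>o\<^sub>p r) + (1 - \<alpha>) *\<^sub>R (B2 powr\<^sub>o\<^sub>p r)))
         + max (norm ((1 - \<alpha>) *\<^sub>R (A1 powr\<^sub>o\<^sub>p r) + \<alpha> *\<^sub>R (B1 powr\<^sub>o\<^sub>p r)))
               (norm ((1 - \<alpha>) *\<^sub>R (A2 powr\<^sub>o\<^sub>p r) + \<alpha> *\<^sub>R (B2 powr\<^sub>o\<^sub>p r))))"
proof -
  let ?N = "max (norm X1 powr r) (norm X2 powr r)"
  have N: "0 \<le> ?N"
    by (simp add: le_max_iff_disj)
  show ?thesis
  proof (intro conjI)
    show "numerical_radius (\<AA> powr\<^sub>o\<^sub>p (1/2) o\<^sub>L \<YY> o\<^sub>L \<BB> powr\<^sub>o\<^sub>p (1/2)) powr r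
      \<le> ?N *
        max (numerical_radius ((1/2) *\<^sub>R (A1 powr\<^sub>o\<^sub>p r + B1 powr\<^sub>o\<^sub>p r)))
            (numerical_radius ((1/2) *\<^sub>R (A2 powr\<^sub>o\<^sub>p r + B2 powr\<^sub>o\<^sub>p r)))"
      unfolding assms(7-9) by (rule numerical_radius_powr_block_le) (use assms in auto)
  next
    \<comment> \<open>Applied blockwise, with the factor 1/2 of
      \<open>numerical_radius_average_le\<close> pulled out of the maximum.\<close>
    have *: "a \<le> 1/2 * c \<Longrightarrow> b \<le> 1/2 * d \<Longrightarrow> ?N * max a b \<le> 1/2 * ?N * max c d" for a b c d
      using mult_left_mono[of "max a b" "1/2 * max c d", OF _ N] by (simp add: max_def split: if_splits)
    show "?N * max (numerical_radius ((1/2) *\<^sub>R (A1 powr\<^sub>o\<^sub>p r + B1 powr\<^sub>o\<^sub>p r)))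
            (numerical_radius ((1/2) *\<^sub>R (A2 powr\<^sub>o\<^sub>p r + B2 powr\<^sub>o\<^sub>p r)))
      \<le> 1/2 * ?N *
        max (numerical_radius (\<alpha> *\<^sub>R (A1 powr\<^sub>o\<^sub>p r) + (1 - \<alpha>) *\<^sub>R (B1 powr\<^sub>o\<^sub>p r))
              + numerical_radius ((1 - \<alpha>) *\<^sub>R (A1 powr\<^sub>o\<^sub>p r) + \<alpha> *\<^sub>R (B1 powr\<^sub>o\<^sub>p r)))
            (numerical_radius (\<alpha> *\<^sub>R (A2 powr\<^sub>o\<^sub>p r) + (1 - \<alpha>) *\<^sub>R (B2 powr\<^sub>o\<^sub>p r))
              + numerical_radius ((1 - \<alpha>) *\<^sub>R (A2 powr\<^sub>o\<^sub>p r) + \<alpha> *\<^sub>R (B2 powr\<^sub>o\<^sub>p r)))"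
      by (intro * numerical_radius_average_le)
  \<comment> \<open>For the third inequality each numerical radius is at most the operator norm, and
    the maximum of sums is at most the sum of maxima.\<close>
  qed (intro mult_left_mono max.boundedI add_mono
      order_trans[OF numerical_radius_le_norm max.cobounded1]
      order_trans[OF numerical_radius_le_norm max.cobounded2], use N in auto)
qed

end
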